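(* Let $(X,\mathcal S(X),\mu,T)$ be a finite measure-preserving ergodic dynamical system. Then either $T$ is W-measurably sensitive, or $T$ is isomorphic mod $0$ to a minimal, uniformly rigid compact group rotation (i.e., a Kronecker transformation).
   Context: A finite measure-preserving dynamical system is $(X,\mathcal S(X),\mu,T)$ (also written $(X,\mu,T)$) where $(X,\mathcal S(X))$ is a standard Borel space, $\mu$ is a nonatomic measure on $\mathcal S(X)$ with $0<\mu(X)<\infty$, and $T:X\to X$ is measurable with $\mu(T^{-1}(A))=\mu(A)$ for all $A\in\mathcal S(X)$. All metrics $d:X\times X\to\mathbb R$ put on $X$ are assumed Borel measurable and bounded by $1$. Such a metric $d$ is $\mu$-compatible if every ball $\{y: d(x,y)<\varepsilon\}$ ($x\in X$, $\varepsilon>0$) has positive $\mu$-measure. For a $\mu$-compatible metric $d$, the system is W-measurably sensitive with respect to $d$ if there is $\delta>0$ such that for every $x\in X$, $\limsup_{n\to\infty} d(T^nx,T^ny)>\delta$ for $\mu$-almost every $y\in X$. The system is W-measurably sensitive if this holds for every $\mu$-compatible metric $d$ on $X$. Isomorphism mod $0$ of $(X,\mu,T)$ and $(X',\mu',T')$: there are Borel sets $U\subset X$, $U'\subset X'$ with $\mu(X\setminus U)=\mu'(X'\setminus U')=0$, $T(U)\subset U$, $T'(U')\subset U'$, and a measure-preserving (bimeasurable) bijection $\phi:U\to U'$ with $\phi\circ T=T'\circ\phi$ on $U$. A compact group rotation is a map $R:G\to G$, $R(h)=gh$, where $G$ is a compact metrizable topological group and $g\in G$, with $G$ carrying Haar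 measure (normalized to have total mass $\mu(X)$). $R$ is minimal if for every $h\in G$ the set of accumulation points of $\{R^nh:n\ge0\}$ is all of $G$; it is uniformly rigid if, for a metric $\rho$ inducing the topology of $G$, there is a sequence $n_i\to\infty$ with $\rho(R^{n_i}h,h)\to0$ uniformly in $h\in G$. *)

theory Defs
  imports "HOL-Analysis.Analysis" "HOL-Algebra.Group"
begin

definition borel_sets_of :: "'a topology \<Rightarrow> 'a set set" where
  "borel_sets_of \<tau> = sigma_sets (topspace \<tau>) {U. openin \<tau> U}"

definition standard_borel :: "'a measure \<Rightarrow> bool" where
  "standard_borel M \<longleftrightarrow>
     (\<exists>\<tau>. completely_metrizable_space \<tau> \<and> separable_space \<tau> \<and>
          topspace \<tau> = space M \<and> sets M = borel_sets_of \<tau>)"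

definition nonatomic :: "'a measure \<Rightarrow> bool" where
  "nonatomic M \<longleftrightarrow>
     (\<forall>A\<in>sets M. 0 < emeasure M A \<longrightarrow>
        (\<exists>B\<in>sets M. B \<subseteq> A \<and> 0 < emeasure M B \<and> emeasure M B < emeasure M A))"

text \<open>Only the behaviour of \<open>T\<close> on \<open>space M\<close> is relevant.\<close>

locale finite_mp_system = finite_measure M for M :: "'a measure" +
  fixes T :: "'a \<Rightarrow> 'a"
  assumes standard: "standard_borel M"
    and nonatomic: "nonatomic M"
    and positive_mass: "0 < emeasure M (space M)"
    and measurable_T: "T \<in> measurable M M"
    and preserving: "\<And>A. A \<in> sets M \<Longrightarrow> emeasure M (T -` A \<inter> space M) = emeasure M A"

definition ergodic :: "'a measure \<Rightarrow> ('a \<Rightarrow> 'a) \<Rightarrow> bool" where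
  "ergodic M T \<longleftrightarrow>
     (\<forall>A\<in>sets M. T -` A \<inter> space M = A \<longrightarrow>
        emeasure M A = 0 \<or> emeasure M (space M - A) = 0)"

text \<open>
  No relation is imposed between the topology of the metric and the Borel structure beyond
  joint measurability of the metric.
\<close>

definition compatible_metric :: "'a measure \<Rightarrow> ('a \<Rightarrow> 'a \<Rightarrow> real) \<Rightarrow> bool" where
  "compatible_metric M d \<longleftrightarrow>
     Metric_space (space M) d \<and>
     (\<lambda>(x, y). d x y) \<in> borel_measurable (M \<Otimes>\<^sub>M M) \<and>
     (\<forall>x\<in>space M. \<forall>y\<in>space M. d x y \<le> 1) \<and>
     (\<forall>x\<in>space M. \<forall>\<epsilon>>0. 0 < emeasure M (Metric_space.mball (space M) d x \<epsilon>))"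

definition W_sensitive_wrt :: "'a measure \<Rightarrow> ('a \<Rightarrow> 'a) \<Rightarrow> ('a \<Rightarrow> 'a \<Rightarrow> real) \<Rightarrow> bool" where
  "W_sensitive_wrt M T d \<longleftrightarrow>
     (\<exists>\<delta>>0. \<forall>x\<in>space M. AE y in M.
        limsup (\<lambda>n. ereal (d ((T ^^ n) x) ((T ^^ n) y))) > ereal \<delta>)"

definition W_measurably_sensitive :: "'a measure \<Rightarrow> ('a \<Rightarrow> 'a) \<Rightarrow> bool" where
  "W_measurably_sensitive M T \<longleftrightarrow> (\<forall>d. compatible_metric M d \<longrightarrow> W_sensitive_wrt M T d)"

definition isomorphic_mod0 ::
  "'a measure \<Rightarrow> ('a \<Rightarrow> 'a) \<Rightarrow> 'b measure \<Rightarrow> ('b \<Rightarrow> 'b) \<Rightarrow> bool" where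
  "isomorphic_mod0 M T M' T' \<longleftrightarrow>
     (\<exists>U\<in>sets M. \<exists>U'\<in>sets M'. \<exists>\<phi>.
        emeasure M (space M - U) = 0 \<and> emeasure M' (space M' - U') = 0 \<and>
        T ` U \<subseteq> U \<and> T' ` U' \<subseteq> U' \<and>
        bij_betw \<phi> U U' \<and>
        \<phi> \<in> measurable (restrict_space M U) (restrict_space M' U') \<and>
        the_inv_into U \<phi> \<in> measurable (restrict_space M' U') (restrict_space M U) \<and>
        (\<forall>A\<in>sets M. A \<subseteq> U \<longrightarrow> emeasure M' (\<phi> ` A) = emeasure M A) \<and>
        (\<forall>x\<in>U. \<phi> (T x) = T' (\<phi> x)))"

locale compact_metrizable_group = group G for G (structure) +
  fixes \<tau> :: "'g topology"
  assumes topspace_eq: "topspace \<tau> = carrier G"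
    and compact: "compact_space \<tau>"
    and metrizable: "metrizable_space \<tau>"
    and continuous_mult: "continuous_map (prod_topology \<tau> \<tau>) \<tau> (\<lambda>(x, y). x \<otimes> y)"
    and continuous_inv: "continuous_map \<tau> \<tau> (\<lambda>x. inv x)"

text \<open>
  A Haar measure with unspecified total mass.  Finite Borel measures on a compact metrizable
  space are automatically regular, so no regularity clause is needed.
\<close>

definition haar_measure :: "('g, 'm) monoid_scheme \<Rightarrow> 'g topology \<Rightarrow> 'g measure \<Rightarrow> bool" where
  "haar_measure G \<tau> m \<longleftrightarrow>
     space m = carrier G \<and> sets m = borel_sets_of \<tau> \<and>
     0 < emeasure m (space m) \<and> emeasure m (space m) < \<infinity> \<and>
     (\<forall>g\<in>carrier G. \<forall>A\<in>sets m. emeasure m ((\<lambda>h. g \<otimes>\<^bsub>G\<^esub> h) ` A) = emeasure m A)"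

definition rotation :: "('g, 'm) monoid_scheme \<Rightarrow> 'g \<Rightarrow> 'g \<Rightarrow> 'g" where
  "rotation G g = (\<lambda>h. g \<otimes>\<^bsub>G\<^esub> h)"

definition minimal_map :: "'g topology \<Rightarrow> ('g \<Rightarrow> 'g) \<Rightarrow> bool" where
  "minimal_map \<tau> R \<longleftrightarrow>
     (\<forall>h\<in>topspace \<tau>. \<tau> derived_set_of (range (\<lambda>n. (R ^^ n) h)) = topspace \<tau>)"

definition uniformly_rigid :: "'g topology \<Rightarrow> ('g \<Rightarrow> 'g) \<Rightarrow> bool" where
  "uniformly_rigid \<tau> R \<longleftrightarrow>
     (\<exists>\<rho>. Metric_space (topspace \<tau>) \<rho> \<and> Metric_space.mtopology (topspace \<tau>) \<rho> = \<tau> \<and>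
        (\<exists>n :: nat \<Rightarrow> nat. filterlim n at_top sequentially \<and>
           uniform_limit (topspace \<tau>) (\<lambda>i h. \<rho> ((R ^^ n i) h) h) (\<lambda>_. 0) sequentially))"

text \<open>
  HOL cannot quantify existentially over types, so the existence of a compact metrizable group
  has to be stated on a fixed type.  The type \<open>nat \<Rightarrow> real\<close> loses nothing: by the
  following lemma every compact metrizable group has a copy on a subset of it, the group
  operations and the topology being transported along the injection.
\<close>

lemma compact_metrizable_inj_seq:
  assumes "compact_space \<tau>" "metrizable_space \<tau>"
  shows "\<exists>f :: 'a \<Rightarrow> nat \<Rightarrow> real. inj_on f (topspace \<tau>)"
proof (cases "topspace \<tau> = {}")
  case False
  obtain M d where "Metric_space M d" and \<tau>: "\<tau> = Metric_space.mtopology M d"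
    using assms(2) unfolding metrizable_space_def by auto
  then interpret Metric_space M d by simp
  have "mtotally_bounded M"
    using assms(1) unfolding \<tau> compact_space_eq_mcomplete_mtotally_bounded by simp
  then have "\<forall>k. \<exists>K. finite K \<and> K \<subseteq> M \<and> M \<subseteq> (\<Union>c\<in>K. mball c (inverse (Suc k)))"
    unfolding mtotally_bounded_def by simp
  then obtain K where K: "\<And>k. finite (K k) \<and> K k \<subseteq> M \<and> M \<subseteq> (\<Union>c\<in>K k. mball c (inverse (Suc k)))"
    by metis
  define C where "C = (\<Union>k. K k)"
  have C: "countable C" "C \<subseteq> M"
    using K unfolding C_def by (auto intro: countable_finite)
  have "C \<noteq> {}"
    using False K unfolding C_def \<tau> by fastforce
  define f where "f x n = d x (from_nat_into C n)" for x and n :: nat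
  have "x = y" if x: "x \<in> M" and y: "y \<in> M" and eq: "f x = f y" for x y
  proof (rule ccontr)
    assume "x \<noteq> y"
    then have pos: "d x y / 2 > 0" using x y by simp
    then obtain k where k: "inverse (Suc k) < d x y / 2"
      using reals_Archimedean by blast
    obtain c where c: "c \<in> K k" "d c x < inverse (Suc k)"
      using K[of k] x by auto
    then have c: "c \<in> C" "d x c < d x y / 2"
      using k commute[of c x] unfolding C_def by auto
    obtain n where "from_nat_into C n = c"
      using C c from_nat_into_surj by metis
    then have "d x c = d y c" using eq unfolding f_def by metis
    moreover have "d x y \<le> d x c + d c y" using c C x y triangle by blast
    ultimately show False using c commute[of c y] by simp
  qed
  then show ?thesis
    unfolding \<tau> by (auto intro!: exI[of _ f] inj_onI)
qed auto

end

theory Submission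
  imports Defs
begin

text \<open>
  Suppose sensitivity fails for a compatible metric \<open>d\<close>, and put \<open>D x y = sup\<^sub>n d (T\<^sup>n x) (T\<^sup>n y)\<close>,
  a measurable metric that \<open>T\<close> does not increase.  Insensitivity and measure preservation give
  \<open>D\<close>-balls of positive measure of every radius, and by ergodicity almost every point is the centre
  of such balls only.  On the set of these points \<open>T\<close> is a \<open>D\<close>-isometry, because the integral of
  \<open>D\<close> is invariant under \<open>T \<times> T\<close>; almost every orbit is \<open>D\<close>-dense, and it is totally bounded since
  all balls of a given radius around its points have measure at least that of the first one.  The
  completion of the orbit is therefore a compact monothetic group on which \<open>T\<close> acts as a
  translation, and the image of the measure is invariant under the closure of the translations
  by orbit points, i.e. it is Haar measure.  Inner regularity makes the resulting injection
  bimeasurable off a null set.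
\<close>

section \<open>The closure of an isometric orbit as a compact monothetic group\<close>

text \<open>The metric \<open>D\<close> is tied to the measurable structure only by joint
  measurability: neither separability nor measurability of its open sets is given. Single balls are
  measurable, so the arguments use countably many radii and, once a dense orbit exists, centres on
  that orbit. The existence of such an orbit comes from Fubini rather than from a countable base.
  \<open>T\<close> is not assumed invertible; inverses in the limit group come from recurrence,
  which total boundedness of the orbit forces. The completion is taken of the index set with the
  distances of the orbit, not of the space: this places the carrier in
  \<open>nat \<Rightarrow> real\<close>, and points of the space then enter as limits of index
  sequences. Nonatomicity makes the orbit infinite; a periodic orbit would give a finite group,
  which has no accumulation points.\<close>

lemma (in Metric_space) tendsto_metric:
  assumes lim: "(\<lambda>n. d (f n) x) \<longlonglongrightarrow> 0" "(\<lambda>n. d (g n) y) \<longlonglongrightarrow> 0"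
    and M: "\<And>n. f n \<in> M" "\<And>n. g n \<in> M" "x \<in> M" "y \<in> M"
  shows "(\<lambda>n. d (f n) (g n)) \<longlonglongrightarrow> d x y"
proof (rule LIM_zero_cancel, rule Lim_null_comparison)
  have "\<bar>d (f n) (g n) - d x y\<bar> \<le> d (f n) x + d (g n) y" for n
    using triangle[OF M(1,3,2), of n n] triangle[OF M(3,4,2), of n]
      triangle[OF M(3,1,4), of n] triangle[OF M(1,2,4), of n n]
    by (simp add: commute abs_le_iff)
  then show "\<forall>\<^sub>F n in sequentially. norm (d (f n) (g n) - d x y) \<le> d (f n) x + d (g n) y"
    by simp
  show "(\<lambda>n. d (f n) x + d (g n) y) \<longlonglongrightarrow> 0"
    using tendsto_add[OF lim] by simp
qed

text \<open>
  The \<open>0\<close>-th orbit point becomes the neutral element and \<open>F m \<cdot> F n = F (m + n)\<close>;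
  the operations extend to the completion along convergent sequences of orbit points.
\<close>

locale isometric_orbit = Metric_space S \<rho> for S :: "'s set" and \<rho> +
  fixes F :: "nat \<Rightarrow> 's"
  assumes complete: "mcomplete"
    and F_in: "F n \<in> S"
    and dense: "\<lbrakk>h \<in> S; \<epsilon> > 0\<rbrakk> \<Longrightarrow> \<exists>i. \<rho> (F i) h < \<epsilon>"
    and shift: "\<rho> (F (i + k)) (F (j + k)) = \<rho> (F i) (F j)"
    and bounded: "mtotally_bounded (range F)"
    and inj: "inj F"
begin

text \<open>Convergence is recorded for sequences of indices instead of points, because the group
  law is addition of indices.\<close>

definition conv :: "(nat \<Rightarrow> nat) \<Rightarrow> 's \<Rightarrow> bool" where
  "conv u h \<longleftrightarrow> h \<in> S \<and> (\<lambda>k. \<rho> (F (u k)) h) \<longlonglongrightarrow> 0"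

lemma conv_in: "conv u h \<Longrightarrow> h \<in> S"
  by (simp add: conv_def)

lemma conv_const: "conv (\<lambda>_. n) (F n)"
  using F_in by (simp add: conv_def)

lemma conv_ex:
  assumes "h \<in> S" shows "\<exists>u. conv u h"
proof -
  have "\<forall>k. \<exists>i. \<rho> (F i) h < inverse (real (Suc k))"
    using dense[OF assms] by simp
  then obtain u where u: "\<And>k. \<rho> (F (u k)) h < inverse (real (Suc k))" by metis
  have "(\<lambda>k. \<rho> (F (u k)) h) \<longlonglongrightarrow> 0"
    by (rule tendsto_sandwich[OF _ _ tendsto_const LIMSEQ_inverse_real_of_nat])
      (use u in \<open>auto intro!: always_eventually less_imp_le\<close>)
  then show ?thesis using assms conv_def by blast
qed

lemma conv_dist:
  assumes "conv u h" "conv v k"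
  shows "(\<lambda>n. \<rho> (F (u n)) (F (v n))) \<longlonglongrightarrow> \<rho> h k"
  using assms F_in unfolding conv_def by (intro tendsto_metric) auto

lemma conv_unique:
  assumes "conv u h" "conv u k" shows "h = k"
proof -
  have "(\<lambda>n. 0) \<longlonglongrightarrow> \<rho> h k" using conv_dist[OF assms] F_in by simp
  then have "\<rho> h k = 0" using LIMSEQ_unique tendsto_const by blast
  then show ?thesis using assms conv_in by simp
qed

lemma conv_close:
  assumes "conv u h" "(\<lambda>n. \<rho> (F (u n)) (F (v n))) \<longlonglongrightarrow> 0"
  shows "conv v h"
  unfolding conv_def
proof
  show S: "h \<in> S" using assms conv_in by auto
  have le: "\<rho> (F (v n)) h \<le> \<rho> (F (u n)) (F (v n)) + \<rho> (F (u n)) h" for n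
    using triangle[OF F_in[of "v n"] F_in[of "u n"] S] commute[of "F (v n)"] by simp
  show "(\<lambda>k. \<rho> (F (v k)) h) \<longlonglongrightarrow> 0"
  proof (rule tendsto_sandwich[OF _ _ tendsto_const])
    show "(\<lambda>n. \<rho> (F (u n)) (F (v n)) + \<rho> (F (u n)) h) \<longlonglongrightarrow> 0"
      using tendsto_add[OF assms(2), of _ 0] assms(1) unfolding conv_def by auto
    show "\<forall>\<^sub>F n in sequentially. \<rho> (F (v n)) h \<le> \<rho> (F (u n)) (F (v n)) + \<rho> (F (u n)) h"
      by (simp add: le)
  qed simp
qed

definition Cauchy_index :: "(nat \<Rightarrow> nat) \<Rightarrow> bool" where
  "Cauchy_index u \<longleftrightarrow> (\<forall>\<epsilon>>0. \<exists>N. \<forall>k\<ge>N. \<forall>l\<ge>N. \<rho> (F (u k)) (F (u l)) < \<epsilon>)"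

lemma Cauchy_index_conv:
  assumes "Cauchy_index u" shows "\<exists>h. conv u h"
proof -
  have "MCauchy (F \<circ> u)"
    using assms F_in unfolding MCauchy_def Cauchy_index_def by auto
  then obtain h where "limitin mtopology (F \<circ> u) h sequentially"
    using complete mcomplete_def by blast
  then show ?thesis
    unfolding limitin_metric_dist_null conv_def by (auto simp: o_def)
qed

lemma conv_Cauchy_index:
  assumes "conv u h" shows "Cauchy_index u"
  unfolding Cauchy_index_def
proof (intro allI impI)
  fix \<epsilon> :: real assume "\<epsilon> > 0"
  then obtain N where N: "\<And>k. k \<ge> N \<Longrightarrow> \<rho> (F (u k)) h < \<epsilon> / 2"
    using assms order_tendstoD(2)[of "\<lambda>k. \<rho> (F (u k)) h" 0 sequentially "\<epsilon> / 2"]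
    unfolding conv_def eventually_sequentially by (metis half_gt_zero)
  have "\<rho> (F (u k)) (F (u l)) < \<epsilon>" if "k \<ge> N" "l \<ge> N" for k l
    using triangle[OF F_in[of "u k"] conv_in[OF assms] F_in[of "u l"]] N[OF that(1)] N[OF that(2)] commute[of h]
    by simp
  then show "\<exists>N. \<forall>k\<ge>N. \<forall>l\<ge>N. \<rho> (F (u k)) (F (u l)) < \<epsilon>" by blast
qed

text \<open>Changing one summand at a time passes through \<open>F (c + b)\<close>, and
  \<open>shift\<close> removes the summand that stays fixed. This joint Lipschitz bound is what lets
  addition of indices extend to limits.\<close>

lemma shift_add: "\<rho> (F (a + b)) (F (c + d)) \<le> \<rho> (F a) (F c) + \<rho> (F b) (F d)"
  using triangle[OF F_in[of "a + b"] F_in[of "c + b"] F_in[of "c + d"]] shift[of a b c]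
    shift[of b c d] by (simp add: add.commute)

lemma shift': "\<rho> (F (k + i)) (F (k + j)) = \<rho> (F i) (F j)"
  using shift[of i k j] by (simp add: add.commute)

lemma Cauchy_index_add:
  assumes "Cauchy_index u" "Cauchy_index v" shows "Cauchy_index (\<lambda>k. u k + v k)"
  unfolding Cauchy_index_def
proof (intro allI impI)
  fix \<epsilon> :: real assume "\<epsilon> > 0"
  then have "\<epsilon> / 2 > 0" by simp
  then obtain N N' where N: "\<And>k l. k \<ge> N \<Longrightarrow> l \<ge> N \<Longrightarrow> \<rho> (F (u k)) (F (u l)) < \<epsilon> / 2"
    and N': "\<And>k l. k \<ge> N' \<Longrightarrow> l \<ge> N' \<Longrightarrow> \<rho> (F (v k)) (F (v l)) < \<epsilon> / 2"
    using assms unfolding Cauchy_index_def by metis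
  have "\<rho> (F (u k + v k)) (F (u l + v l)) < \<epsilon>" if "k \<ge> max N N'" "l \<ge> max N N'" for k l
    using shift_add[of "u k" "v k" "u l" "v l"] N[of k l] N'[of k l] that by simp
  then show "\<exists>N. \<forall>k\<ge>N. \<forall>l\<ge>N. \<rho> (F (u k + v k)) (F (u l + v l)) < \<epsilon>" by blast
qed

definition mult :: "'s \<Rightarrow> 's \<Rightarrow> 's" where
  "mult h k = (SOME p. \<exists>u v. conv u h \<and> conv v k \<and> conv (\<lambda>n. u n + v n) p)"

text \<open>By \<open>shift_add\<close> sums of Cauchy index sequences are Cauchy, so completeness
  supplies a limit, and two choices of representing sequences have sums whose distance tends to 0.
  Hence the choice in \<open>mult\<close> is immaterial, and commutativity and associativity reduce
  to those of addition on \<open>nat\<close>.\<close>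

lemma conv_mult:
  assumes "conv u h" "conv v k" shows "conv (\<lambda>n. u n + v n) (mult h k)"
proof -
  obtain p where "conv (\<lambda>n. u n + v n) p"
    using Cauchy_index_conv Cauchy_index_add conv_Cauchy_index assms by meson
  then have "\<exists>p u v. conv u h \<and> conv v k \<and> conv (\<lambda>n. u n + v n) p" using assms by blast
  from someI_ex[OF this] obtain u' v'
    where c: "conv u' h" "conv v' k" "conv (\<lambda>n. u' n + v' n) (mult h k)" unfolding mult_def by blast
  have "(\<lambda>n. \<rho> (F (u' n)) (F (u n))) \<longlonglongrightarrow> 0" "(\<lambda>n. \<rho> (F (v' n)) (F (v n))) \<longlonglongrightarrow> 0"
    using conv_dist[OF c(1) assms(1)] conv_dist[OF c(2) assms(2)] conv_in[OF assms(1)] conv_in[OF assms(2)]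
    by auto
  from tendsto_add[OF this] have "(\<lambda>n. \<rho> (F (u' n)) (F (u n)) + \<rho> (F (v' n)) (F (v n))) \<longlonglongrightarrow> 0"
    by simp
  then have "(\<lambda>n. \<rho> (F (u' n + v' n)) (F (u n + v n))) \<longlonglongrightarrow> 0"
    by (rule tendsto_sandwich[OF _ _ tendsto_const, rotated 2]) (auto intro!: always_eventually shift_add)
  with c(3) show ?thesis by (rule conv_close)
qed

lemma mult_in: "h \<in> S \<Longrightarrow> k \<in> S \<Longrightarrow> mult h k \<in> S"
  using conv_ex conv_mult conv_in by meson

lemma mult_commute: assumes "h \<in> S" "k \<in> S" shows "mult h k = mult k h"
proof -
  obtain u v where uv: "conv u h" "conv v k" using conv_ex assms by metis
  then show ?thesis
    using conv_unique[OF conv_mult[OF uv]] conv_mult[OF uv(2,1)] by (simp add: add.commute)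
qed

lemma mult_assoc: assumes "h \<in> S" "k \<in> S" "l \<in> S" shows "mult (mult h k) l = mult h (mult k l)"
proof -
  obtain u v w where uv: "conv u h" "conv v k" "conv w l" using conv_ex assms by metis
  then show ?thesis
    using conv_unique[OF conv_mult[OF conv_mult[OF uv(1,2)] uv(3)]] conv_mult[OF uv(1) conv_mult[OF uv(2,3)]]
    by (simp add: add.assoc)
qed

lemma mult_one: assumes "h \<in> S" shows "mult (F 0) h = h"
proof -
  obtain u where u: "conv u h" using conv_ex assms by metis
  then show ?thesis using conv_unique conv_mult[OF conv_const[of 0] u] by simp
qed

lemma mult_F: "mult (F m) (F n) = F (m + n)"
  using conv_unique[OF conv_mult[OF conv_const conv_const]] conv_const by simp

lemma mult_dist: assumes "h \<in> S" "k \<in> S" "l \<in> S" shows "\<rho> (mult l h) (mult l k) = \<rho> h k"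
proof -
  obtain u v w where uv: "conv u h" "conv v k" "conv w l" using conv_ex assms by metis
  show ?thesis
    using LIMSEQ_unique[OF conv_dist[OF conv_mult[OF uv(3,1)] conv_mult[OF uv(3,2)]]] conv_dist[OF uv(1,2)]
    by (simp add: shift')
qed

lemma mult_dist': assumes "h \<in> S" "k \<in> S" "l \<in> S" shows "\<rho> (mult h l) (mult k l) = \<rho> h k"
  using mult_dist mult_commute assms by metis

lemma mult_dist_le:
  assumes "h \<in> S" "k \<in> S" "h' \<in> S" "k' \<in> S"
  shows "\<rho> (mult h k) (mult h' k') \<le> \<rho> h h' + \<rho> k k'"
  using triangle[OF mult_in[OF assms(1,2)] mult_in[OF assms(3,2)] mult_in[OF assms(3,4)]]
    mult_dist[OF assms(2,4,3)] mult_dist'[OF assms(1,3,2)] by simp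

text \<open>Two late terms of a Cauchy subsequence are close, and \<open>shift\<close> turns their
  distance into that between \<open>F 0\<close> and the term at the index difference. The difference
  is at least N because a strictly increasing \<open>r\<close> grows by at least one per
  step.\<close>

lemma recurrent: assumes "\<epsilon> > 0" shows "\<exists>n\<ge>N. \<rho> (F n) (F 0) < \<epsilon>"
proof -
  obtain r where r: "strict_mono r" "MCauchy (F \<circ> r)"
    using bounded unfolding mtotally_bounded_sequentially by blast
  then obtain K where K: "\<And>k l. k \<ge> K \<Longrightarrow> l \<ge> K \<Longrightarrow> \<rho> (F (r k)) (F (r l)) < \<epsilon>"
    using assms unfolding MCauchy_def by (auto simp: o_def) metis
  have ge: "r (K + n) \<ge> r K + n" for n
  proof (induction n)
    case (Suc n)
    have "r (K + n) < r (K + Suc n)" using r(1) by (simp add: strict_mono_def)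
    with Suc show ?case by simp
  qed simp
  have "\<rho> (F (r (K + N) - r K)) (F 0) = \<rho> (F (r (K + N))) (F (r K))"
    using shift[of "r (K + N) - r K" "r K" 0] ge[of N] by simp
  also have "\<dots> < \<epsilon>" using K by simp
  finally show ?thesis using ge[of N] by (intro exI[of _ "r (K + N) - r K"]) auto
qed

text \<open>If \<open>F (u k) \<rightarrow> h\<close> and \<open>F (m k) \<rightarrow> F 0\<close> with \<open>m k \<ge> u k\<close>, then \<open>F (m k - u k)\<close> converges to the inverse of \<open>h\<close>.\<close>

lemma mult_inverse: assumes "h \<in> S" shows "\<exists>k\<in>S. mult k h = F 0"
proof -
  obtain u where u: "conv u h" using conv_ex assms by metis
  have "\<forall>k. \<exists>m\<ge>u k. \<rho> (F m) (F 0) < inverse (real (Suc k))"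
    by (intro allI recurrent) simp
  then obtain m where m: "\<And>k. m k \<ge> u k" "\<And>k. \<rho> (F (m k)) (F 0) < inverse (real (Suc k))" by metis
  have "(\<lambda>k. \<rho> (F (m k)) (F 0)) \<longlonglongrightarrow> 0"
    by (rule tendsto_sandwich[OF _ _ tendsto_const LIMSEQ_inverse_real_of_nat])
      (use m in \<open>auto intro!: always_eventually less_imp_le\<close>)
  then have cm: "conv m (F 0)" using F_in by (simp add: conv_def)
  define v where "v k = m k - u k" for k
  have uv: "v k + u k = m k" for k using m(1)[of k] by (simp add: v_def)
  have "Cauchy_index v"
    unfolding Cauchy_index_def
  proof (intro allI impI)
    fix \<epsilon> :: real assume "\<epsilon> > 0"
    then have "\<epsilon> / 2 > 0" by simp
    then obtain N N' where N: "\<And>k l. k \<ge> N \<Longrightarrow> l \<ge> N \<Longrightarrow> \<rho> (F (u k)) (F (u l)) < \<epsilon> / 2"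
      and N': "\<And>k l. k \<ge> N' \<Longrightarrow> l \<ge> N' \<Longrightarrow> \<rho> (F (m k)) (F (m l)) < \<epsilon> / 2"
      using conv_Cauchy_index[OF u] conv_Cauchy_index[OF cm] unfolding Cauchy_index_def by metis
    have "\<rho> (F (v k)) (F (v l)) < \<epsilon>" if "k \<ge> max N N'" "l \<ge> max N N'" for k l
    proof -
      \<comment> \<open>Both indices are raised by \<open>u k + u l\<close>: each then contains a
        full term \<open>m = v + u\<close>, and the remainder is the \<open>u\<close> of the other
        index.\<close>
      have "\<rho> (F (v k)) (F (v l)) = \<rho> (F (v k + (u k + u l))) (F (v l + (u k + u l)))"
        by (simp add: shift)
      also have "\<dots> = \<rho> (F (m k + u l)) (F (m l + u k))"
        by (metis add.assoc add.commute uv)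
      also have "\<dots> \<le> \<rho> (F (m k)) (F (m l)) + \<rho> (F (u l)) (F (u k))" by (rule shift_add)
      also have "\<dots> < \<epsilon>" using N[of l k] N'[of k l] that by simp
      finally show ?thesis .
    qed
    then show "\<exists>N. \<forall>k\<ge>N. \<forall>l\<ge>N. \<rho> (F (v k)) (F (v l)) < \<epsilon>" by blast
  qed
  then obtain k where k: "conv v k" using Cauchy_index_conv by blast
  have "conv m (mult k h)" using conv_mult[OF k u] by (simp add: uv)
  then show ?thesis using conv_unique cm conv_in k by blast
qed

section \<open>The limit group and its topology\<close>

definition G :: "'s monoid" where
  "G = \<lparr>carrier = S, monoid.mult = mult, one = F 0\<rparr>"

lemma G_simps [simp]: "carrier G = S" "monoid.mult G = mult" "one G = F 0"
  by (simp_all add: G_def)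

lemma group_G: "group G"
  by (rule groupI) (auto simp: mult_in mult_assoc mult_one F_in mult_inverse)

lemma compact_G: "compact_space mtopology"
proof -
  have "mtopology closure_of (range F) = S"
    using F_in dense by (auto simp: metric_closure_of commute)
  then have "mtotally_bounded S" using mtotally_bounded_closure_of[OF bounded] by simp
  then show ?thesis using complete compact_space_eq_mcomplete_mtotally_bounded by blast
qed

lemma inv_in: "h \<in> S \<Longrightarrow> inv\<^bsub>G\<^esub> h \<in> S"
  using group.inv_closed[OF group_G] by simp

lemma mult_inv: "h \<in> S \<Longrightarrow> mult h (inv\<^bsub>G\<^esub> h) = F 0" "h \<in> S \<Longrightarrow> mult (inv\<^bsub>G\<^esub> h) h = F 0"
  using group.r_inv[OF group_G] group.l_inv[OF group_G] by auto

text \<open>Translation by the product of h and k is an isometry and, by commutativity, sends the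
  two inverses to k and h.\<close>

lemma inv_dist:
  assumes "h \<in> S" "k \<in> S" shows "\<rho> (inv\<^bsub>G\<^esub> h) (inv\<^bsub>G\<^esub> k) = \<rho> h k"
proof -
  let ?h = "inv\<^bsub>G\<^esub> h" and ?k = "inv\<^bsub>G\<^esub> k"
  note [simp] = inv_in assms mult_in mult_one
  have 1: "mult (mult h k) ?h = k" 
    using mult_commute[of h k] mult_assoc[of k h ?h] mult_commute[of k "F 0"] by (simp add: mult_inv F_in)
  have 2: "mult (mult h k) ?k = h"
    using mult_assoc[of h k ?k] mult_commute[of h "F 0"] by (simp add: mult_inv F_in)
  have "\<rho> ?h ?k = \<rho> (mult (mult h k) ?h) (mult (mult h k) ?k)"
    by (subst mult_dist) auto
  then show ?thesis by (simp only: 1 2 commute)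
qed

lemma compact_metrizable_group_G: "compact_metrizable_group G mtopology"
proof (intro compact_metrizable_group.intro group_G compact_metrizable_group_axioms.intro compact_G)
  show "metrizable_space mtopology" by (rule metrizable_space_mtopology)
  show "continuous_map (prod_topology mtopology mtopology) mtopology (\<lambda>(x, y). x \<otimes>\<^bsub>G\<^esub> y)"
    unfolding continuous_map_to_metric
  proof (intro ballI allI impI)
    fix x and \<epsilon> :: real assume x: "x \<in> topspace (prod_topology mtopology mtopology)" and \<epsilon>: "\<epsilon> > 0"
    obtain a b where ab: "x = (a, b)" "a \<in> S" "b \<in> S" using x by auto
    show "\<exists>U. openin (prod_topology mtopology mtopology) U \<and> x \<in> U \<and>
             (\<forall>y\<in>U. (case y of (x, y) \<Rightarrow> x \<otimes>\<^bsub>G\<^esub> y) \<in> mball (case x of (x, y) \<Rightarrow> x \<otimes>\<^bsub>G\<^esub> y) \<epsilon>)"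
    proof (intro exI conjI)
      show "openin (prod_topology mtopology mtopology) (mball a (\<epsilon>/2) \<times> mball b (\<epsilon>/2))"
        by (simp add: openin_prod_Times_iff)
      show "x \<in> mball a (\<epsilon>/2) \<times> mball b (\<epsilon>/2)" using ab \<epsilon> by simp
      have "\<rho> (mult a b) (mult c e) < \<epsilon>" if "c \<in> S" "e \<in> S" "\<rho> a c * 2 < \<epsilon>" "\<rho> b e * 2 < \<epsilon>" for c e
        using mult_dist_le[OF ab(2,3) that(1,2)] that by simp
      then show "\<forall>y\<in>mball a (\<epsilon>/2) \<times> mball b (\<epsilon>/2). (case y of (x, y) \<Rightarrow> x \<otimes>\<^bsub>G\<^esub> y) \<in> mball (case x of (x, y) \<Rightarrow> x \<otimes>\<^bsub>G\<^esub> y) \<epsilon>"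
        using ab by (auto simp: mult_in)
    qed
  qed
  show "continuous_map mtopology mtopology (\<lambda>x. inv\<^bsub>G\<^esub> x)"
    unfolding continuous_map_to_metric
  proof (intro ballI allI impI)
    fix x and \<epsilon> :: real assume "x \<in> topspace mtopology" "\<epsilon> > 0"
    then show "\<exists>U. openin mtopology U \<and> x \<in> U \<and> (\<forall>y\<in>U. inv\<^bsub>G\<^esub> y \<in> mball (inv\<^bsub>G\<^esub> x) \<epsilon>)"
      by (intro exI[of _ "mball x \<epsilon>"]) (auto simp: inv_dist inv_in)
  qed
qed simp

section \<open>Minimality and uniform rigidity of the rotation\<close>

lemma rotation_power: "h \<in> S \<Longrightarrow> (rotation G (F 1) ^^ n) h = mult (F n) h"
proof (induction n)
  case (Suc n)
  then have "(rotation G (F 1) ^^ Suc n) h = mult (F 1) (mult (F n) h)" by (simp add: rotation_def)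
  then show ?case using Suc mult_assoc[of "F 1" "F n" h] F_in mult_F by simp
qed (simp add: mult_one)

text \<open>An accumulation point y needs a nearby orbit point other than y itself. Density gives an
  m whose orbit point is within \<open>r / 2\<close> of y, and a return time n of at least 1 keeps
  the point at time \<open>m + n\<close> within r. These two points differ by injectivity of
  \<open>F\<close>, so at least one of them is not y.\<close>

lemma minimal_rotation: "minimal_map mtopology (rotation G (F 1))"
  unfolding minimal_map_def metric_derived_set_of topspace_mtopology
proof (intro ballI equalityI subsetI CollectI conjI allI impI)
  fix h y and r :: real assume h: "h \<in> S" and y: "y \<in> S" and r: "r > 0"
  note [simp] = mult_in inv_in F_in
  have "mult y (inv\<^bsub>G\<^esub> h) \<in> S" using h y by simp
  then obtain m where m: "\<rho> (F m) (mult y (inv\<^bsub>G\<^esub> h)) < r / 2"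
    using dense r by (meson half_gt_zero)
  obtain n where n: "n \<ge> 1" "\<rho> (F n) (F 0) < r / 2" using recurrent[of "r / 2" 1] r by auto
  have yh: "mult (mult y (inv\<^bsub>G\<^esub> h)) h = y"
    using mult_assoc[of y "inv\<^bsub>G\<^esub> h" h] h y mult_commute[of y "F 0"] by (simp add: mult_inv mult_one)
  have 1: "\<rho> y (mult (F m) h) < r / 2"
    using m mult_dist'[of "F m" "mult y (inv\<^bsub>G\<^esub> h)" h] h y by (simp add: yh commute)
  have "\<rho> (mult (F m) h) (mult (F (m + n)) h) = \<rho> (F (m + 0)) (F (m + n))"
    using h by (simp add: mult_dist')
  also have "\<dots> = \<rho> (F 0) (F n)" by (rule shift')
  also have "\<dots> < r / 2" using n by (simp add: commute)
  finally have 2: "\<rho> (mult (F m) h) (mult (F (m + n)) h) < r / 2" .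
  have 3: "\<rho> y (mult (F (m + n)) h) < r"
    using triangle[of y "mult (F m) h" "mult (F (m + n)) h"] 1 2 h y by simp
  have "F m \<noteq> F (m + n)" using inj n by (auto dest: injD)
  then have "mult (F m) h \<noteq> mult (F (m + n)) h"
    using mult_dist'[of "F m" "F (m + n)" h] h by (metis F_in mult_in zero)
  moreover have "mult (F k) h \<in> range (\<lambda>n. (rotation G (F 1) ^^ n) h)" for k
    using rotation_power[OF h] by (metis rangeI)
  moreover have "mult (F m) h \<in> mball y r" "mult (F (m + n)) h \<in> mball y r"
    using 1 3 h y r by simp_all
  ultimately show "\<exists>z\<in>range (\<lambda>n. (rotation G (F 1) ^^ n) h). z \<noteq> y \<and> z \<in> mball y r" by metis
qed simp_all

text \<open>Since translations are isometries, the n-th power displaces every point by exactly the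
  distance from \<open>F n\<close> to \<open>F 0\<close>; recurrence times therefore serve all
  points at once.\<close>

lemma uniformly_rigid_rotation: "uniformly_rigid mtopology (rotation G (F 1))"
proof -
  have "\<forall>k. \<exists>n\<ge>k. \<rho> (F n) (F 0) < inverse (real (Suc k))"
    by (intro allI recurrent) simp
  then obtain n where n: "\<And>k. n k \<ge> k" "\<And>k. \<rho> (F (n k)) (F 0) < inverse (real (Suc k))" by metis
  have lim: "(\<lambda>k. \<rho> (F (n k)) (F 0)) \<longlonglongrightarrow> 0"
    by (rule tendsto_sandwich[OF _ _ tendsto_const LIMSEQ_inverse_real_of_nat])
      (use n in \<open>auto intro!: always_eventually less_imp_le\<close>)
  have eq: "\<rho> ((rotation G (F 1) ^^ n i) h) h = \<rho> (F (n i)) (F 0)" if "h \<in> S" for i h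
    using mult_dist'[of "F (n i)" "F 0" h] that rotation_power[OF that] by (simp add: mult_one F_in)
  have "uniform_limit S (\<lambda>i h. \<rho> ((rotation G (F 1) ^^ n i) h) h) (\<lambda>_. 0) sequentially"
    unfolding uniform_limit_iff
  proof (intro allI impI)
    fix e :: real assume "e > 0"
    from order_tendstoD(2)[OF lim this]
    show "\<forall>\<^sub>F i in sequentially. \<forall>h\<in>S. dist (\<rho> ((rotation G (F 1) ^^ n i) h) h) 0 < e"
      by eventually_elim (simp add: eq[unfolded One_nat_def])
  qed
  moreover have "filterlim n at_top sequentially"
    using n(1) by (intro filterlim_at_top_mono[OF filterlim_ident]) auto
  ultimately show ?thesis
    unfolding uniformly_rigid_def topspace_mtopology using Metric_space_axioms by blast
qed

end

text \<open>The Kuratowski embedding sends i to the function \<open>\<delta> i\<close>, an isometry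
  into the bounded functions with the supremum distance; the completion is the closure of its image.
  Every function on \<open>nat\<close> is continuous, so \<open>bcontfun\<close> imposes boundedness
  only. The last conclusion, that evaluations are 1-Lipschitz, later compares the topology of \<rho>
  with the Borel sets of \<open>nat \<Rightarrow> real\<close>.\<close>

lemma metric_completion_seq:
  fixes \<delta> :: "nat \<Rightarrow> nat \<Rightarrow> real"
  assumes "Metric_space UNIV \<delta>" and le1: "\<And>i j. \<delta> i j \<le> 1"
  obtains S :: "(nat \<Rightarrow> real) set" and \<rho> F
  where "Metric_space S \<rho>" "Metric_space.mcomplete S \<rho>" "\<And>n. F n \<in> S"
    "\<And>i j. \<rho> (F i) (F j) = \<delta> i j" "\<And>h \<epsilon>. h \<in> S \<Longrightarrow> \<epsilon> > 0 \<Longrightarrow> \<exists>i. \<rho> (F i) h < \<epsilon>"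
    "\<And>h k n. h \<in> S \<Longrightarrow> k \<in> S \<Longrightarrow> \<bar>h n - k n\<bar> \<le> \<rho> h k"
proof -
  interpret D: Metric_space UNIV \<delta> by fact
  define F' :: "nat \<Rightarrow> nat \<Rightarrow>\<^sub>C real" where "F' i = Bcontfun (\<delta> i)" for i
  have bc: "\<delta> i \<in> bcontfun" for i
  proof -
    have "bounded (range (\<delta> i))"
      using le1 by (intro boundedI[of _ 1]) auto
    then show ?thesis by (simp add: bcontfun_def)
  qed
  have app: "apply_bcontfun (F' i) = \<delta> i" for i
    unfolding F'_def using bc by (rule Bcontfun_inverse)
  have dF: "dist (F' i) (F' j) = \<delta> i j" for i j
  proof (rule antisym)
    show "dist (F' i) (F' j) \<le> \<delta> i j"
    proof (rule dist_bound)
      fix n show "dist (apply_bcontfun (F' i) n) (apply_bcontfun (F' j) n) \<le> \<delta> i j"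
        using D.triangle[of i j n] D.triangle[of j i n] by (simp add: app dist_real_def D.commute abs_le_iff)
    qed
    \<comment> \<open>The supremum is attained at the argument j, where \<open>\<delta> j j\<close>
      vanishes.\<close>
    show "\<delta> i j \<le> dist (F' i) (F' j)"
      using dist_bounded[of "F' i" j "F' j"] by (simp add: app dist_real_def)
  qed
  define S' where "S' = closure (range F')"
  define \<rho> :: "(nat \<Rightarrow> real) \<Rightarrow> (nat \<Rightarrow> real) \<Rightarrow> real" where "\<rho> h k = dist (Bcontfun h) (Bcontfun k)" for h k
  define S where "S = apply_bcontfun ` S'"
  have \<rho>: "\<rho> (apply_bcontfun f) (apply_bcontfun g) = dist f g" for f g
    by (simp add: \<rho>_def apply_bcontfun_inverse)
  have MS: "Metric_space S \<rho>"
  proof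
    fix x y z assume "x \<in> S" "y \<in> S" "z \<in> S"
    then show "\<rho> x z \<le> \<rho> x y + \<rho> y z" by (auto simp: S_def \<rho> dist_triangle)
  qed (auto simp: \<rho>_def dist_commute S_def apply_bcontfun_inverse)
  then interpret S: Metric_space S \<rho> .
  have compl: "S.mcomplete"
    unfolding S.mcomplete_def
  proof (intro allI impI)
    fix \<sigma> assume \<sigma>: "S.MCauchy \<sigma>"
    then have in_S: "\<sigma> n \<in> S" for n by (auto simp: S.MCauchy_def)
    have "\<exists>f. f \<in> S' \<and> \<sigma> n = apply_bcontfun f" for n using in_S[of n] by (auto simp: S_def)
    then obtain s where s: "\<And>n. s n \<in> S'" "\<And>n. \<sigma> n = apply_bcontfun (s n)" by metis
    have "Cauchy s"
      using \<sigma> unfolding S.MCauchy_def Cauchy_def by (auto simp: s(2) \<rho>)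
    then obtain g where "uniform_limit UNIV (\<lambda>k. apply_bcontfun (s k)) g sequentially"
      using uniformly_convergent_eq_cauchy[of "\<lambda>_. True" "\<lambda>k. apply_bcontfun (s k)"]
      unfolding Cauchy_def uniform_limit_sequentially_iff
      by (metis dist_fun_lt_imp_dist_val_lt)
    from uniform_limit_bcontfunE[OF this sequentially_bot]
    obtain l where l: "s \<longlonglongrightarrow> l" by metis
    have "l \<in> S'" using closed_sequentially[OF _ _ l, of S'] s(1) by (simp add: S'_def)
    moreover have "(\<lambda>n. dist (s n) l) \<longlonglongrightarrow> 0" using l by (rule tendsto_dist_iff[THEN iffD1])
    ultimately have "limitin S.mtopology \<sigma> (apply_bcontfun l) sequentially"
      unfolding S.limitin_metric_dist_null using s by (auto simp: S_def \<rho>)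
    then show "\<exists>x. limitin S.mtopology \<sigma> x sequentially" by blast
  qed
  show thesis
  proof (rule that[of S \<rho> "\<lambda>i. apply_bcontfun (F' i)"])
    show "apply_bcontfun (F' n) \<in> S" for n
      unfolding S_def S'_def using closure_subset[of "range F'"] by blast
    show "\<exists>i. \<rho> (apply_bcontfun (F' i)) h < \<epsilon>" if "h \<in> S" "\<epsilon> > 0" for h \<epsilon>
    proof -
      obtain f where "f \<in> closure (range F')" "h = apply_bcontfun f"
        using \<open>h \<in> S\<close> by (auto simp: S_def S'_def)
      then show ?thesis using \<open>\<epsilon> > 0\<close> by (auto simp: closure_approachable \<rho>)
    qed
    show "\<bar>h n - k n\<bar> \<le> \<rho> h k" if "h \<in> S" "k \<in> S" for h k n
    proof -
      obtain f g where "h = apply_bcontfun f" "k = apply_bcontfun g"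
        using \<open>h \<in> S\<close> \<open>k \<in> S\<close> by (auto simp: S_def)
      then show ?thesis using dist_bounded[of f n g] by (simp add: \<rho> dist_real_def)
    qed
  qed (use MS compl \<rho> dF in auto)
qed

section \<open>Haar measure on the limit group\<close>

lemma (in Metric_space) sigma_sets_closed:
  "sigma_sets M {C. closedin mtopology C} = borel_sets_of mtopology"
  unfolding borel_sets_of_def topspace_mtopology
proof (intro antisym sigma_sets_mono subsetI)
  fix C assume "C \<in> {C. closedin mtopology C}"
  then have "C = M - (M - C)" "openin mtopology (M - C)" by (auto simp: closedin_def)
  then show "C \<in> sigma_sets M {U. openin mtopology U}"
    by (metis mem_Collect_eq sigma_sets.Basic sigma_sets.Compl)
next
  fix U assume "U \<in> {U. openin mtopology U}"
  then have "U = M - (M - U)" "closedin mtopology (M - U)" by (auto simp: openin_closedin_eq)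
  then show "U \<in> sigma_sets M {U. closedin mtopology U}"
    by (metis mem_Collect_eq sigma_sets.Basic sigma_sets.Compl)
qed

context isometric_orbit
begin

lemma continuous_mult: assumes "h \<in> S" shows "continuous_map mtopology mtopology (mult h)"
  unfolding continuous_map_to_metric
proof (intro ballI allI impI)
  fix x and \<epsilon> :: real assume "x \<in> topspace mtopology" "\<epsilon> > 0"
  then show "\<exists>U. openin mtopology U \<and> x \<in> U \<and> (\<forall>y\<in>U. mult h y \<in> mball (mult h x) \<epsilon>)"
    using assms by (intro exI[of _ "mball x \<epsilon>"]) (auto simp: mult_dist mult_in)
qed

text \<open>
  Translations by orbit points preserve \<open>\<nu>\<close>.  For closed \<open>C\<close> and arbitrary \<open>h\<close>, approximating \<open>h\<close>
  by orbit points bounds the preimage of \<open>C\<close> by the neighbourhoods of \<open>C\<close>; applying this to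
  \<open>h\<close> and to its inverse gives invariance on closed sets.
\<close>

lemma haar_measure_G:
  assumes sp: "space \<nu> = S" and sets: "sets \<nu> = borel_sets_of mtopology"
    and pos: "0 < emeasure \<nu> (space \<nu>)" and fin: "emeasure \<nu> (space \<nu>) < \<infinity>"
    and invariant: "\<And>A. A \<in> sets \<nu> \<Longrightarrow> emeasure \<nu> {x \<in> S. mult (F 1) x \<in> A} = emeasure \<nu> A"
  shows "haar_measure G mtopology \<nu>"
proof -
  interpret finite_measure \<nu> using fin by (intro finite_measureI) simp
  have open_sets: "U \<in> sets \<nu>" if "openin mtopology U" for U
    using that unfolding sets borel_sets_of_def by (auto intro: sigma_sets.Basic)
  have closed_sets: "C \<in> sets \<nu>" if "closedin mtopology C" for C
    using that unfolding sets sigma_sets_closed[symmetric] by (auto intro: sigma_sets.Basic)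
  define P where "P h A = {x \<in> S. mult h x \<in> A}" for h A
  have meas: "mult h \<in> measurable \<nu> \<nu>" if "h \<in> S" for h
  proof (rule measurable_sigma_sets[where \<Omega> = S and A = "{U. openin mtopology U}"])
    show "sets \<nu> = sigma_sets S {U. openin mtopology U}" by (simp add: sets borel_sets_of_def)
    fix U assume "U \<in> {U. openin mtopology U}"
    then have "openin mtopology {x \<in> topspace mtopology. mult h x \<in> U}"
      using continuous_mult[OF that] by (intro openin_continuous_map_preimage) auto
    then show "mult h -` U \<inter> space \<nu> \<in> sets \<nu>"
      using open_sets by (simp add: sp vimage_def Int_def conj_commute)
  qed (use that in \<open>auto simp: sp mult_in openin_mtopology\<close>)
  have P_vimage: "P h A = mult h -` A \<inter> space \<nu>" for h A by (auto simp: P_def sp)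
  have P_sets: "P h A \<in> sets \<nu>" if "h \<in> S" "A \<in> sets \<nu>" for h A
    unfolding P_vimage using meas that measurable_sets by blast
  have P_inv: "P (inv\<^bsub>G\<^esub> h) (P h A) = A" if "h \<in> S" "A \<subseteq> S" for h A
    using that by (auto simp: P_def inv_in mult_in mult_inv mult_one simp flip: mult_assoc)
  have orbit: "emeasure \<nu> (P (F n) A) = emeasure \<nu> A" if "A \<in> sets \<nu>" for n A
  proof (induction n)
    case 0
    have "P (F 0) A = A" using sets.sets_into_space[OF that] by (auto simp: P_def mult_one sp)
    then show ?case by simp
  next
    case (Suc n)
    have "mult (F (Suc n)) x = mult (F n) (mult (F 1) x)" if "x \<in> S" for x
      using mult_assoc[OF F_in F_in that, of n 1] mult_F[of n 1] by simp
    then have "P (F (Suc n)) A = {x \<in> S. mult (F 1) x \<in> P (F n) A}"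
      by (auto simp: P_def mult_in F_in)
    then show ?case using invariant[OF P_sets[OF F_in that]] Suc by simp
  qed
  have le: "emeasure \<nu> (P h C) \<le> emeasure \<nu> C" if h: "h \<in> S" and C: "closedin mtopology C" for h C
  proof -
    have CS: "C \<subseteq> S" using closedin_subset[OF C] by simp
    define N where "N k = (\<Union>c\<in>C. mball c (inverse (real (Suc k))))" for k
    have N_sets: "N k \<in> sets \<nu>" for k unfolding N_def by (intro open_sets openin_Union) auto
    have "decseq N"
    proof (rule decseq_SucI)
      fix k show "N (Suc k) \<subseteq> N k"
        unfolding N_def by (intro UN_mono mball_subset_concentric le_imp_inverse_le) auto
    qed
    have "(\<Inter>k. N k) = C"
    proof (intro equalityI subsetI)
      fix x assume x: "x \<in> (\<Inter>k. N k)"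
      then have xS: "x \<in> S" by (auto simp: N_def)
      have "x \<in> mtopology closure_of C"
        unfolding metric_closure_of
      proof (intro CollectI conjI allI impI)
        fix r :: real assume "r > 0"
        then obtain k where k: "inverse (real (Suc k)) < r" using reals_Archimedean by blast
        obtain c where "c \<in> C" "\<rho> c x < inverse (real (Suc k))" using x by (auto simp: N_def)
        then show "\<exists>y\<in>C. y \<in> mball x r" using k xS CS by (intro bexI[of _ c]) (auto simp: commute)
      qed fact
      then show "x \<in> C" using C closure_of_closedin by blast
    next
      fix x assume "x \<in> C"
      then show "x \<in> (\<Inter>k. N k)" using CS by (auto simp: N_def intro!: bexI[of _ x])
    qed
    then have lim: "(\<lambda>k. emeasure \<nu> (N k)) \<longlonglongrightarrow> emeasure \<nu> C"
      using Lim_emeasure_decseq[of N \<nu>] N_sets \<open>decseq N\<close> by auto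
    show ?thesis
    proof (rule LIMSEQ_le_const[OF lim], intro exI allI impI)
      fix k :: nat
      obtain i where i: "\<rho> (F i) h < inverse (real (Suc k))"
        using dense[OF h, of "inverse (real (Suc k))"] by auto
      \<comment> \<open>Translations are isometric, so replacing h by \<open>F i\<close> moves every
        product by the same small amount, whatever x is; a product in C ends in the neighbourhood
        \<open>N k\<close>.\<close>
      have "P h C \<subseteq> P (F i) (N k)"
      proof
        fix x assume "x \<in> P h C"
        then have x: "x \<in> S" "mult h x \<in> C" by (auto simp: P_def)
        have "\<rho> (mult h x) (mult (F i) x) < inverse (real (Suc k))"
          using mult_dist'[OF h F_in x(1)] i by (simp add: commute)
        then show "x \<in> P (F i) (N k)" using x h by (auto simp: P_def N_def mult_in F_in intro!: bexI[of _ "mult h x"])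
      qed
      then have "emeasure \<nu> (P h C) \<le> emeasure \<nu> (P (F i) (N k))"
        using P_sets[OF F_in N_sets] by (rule emeasure_mono)
      then show "emeasure \<nu> (P h C) \<le> emeasure \<nu> (N k)" by (simp add: orbit N_sets)
    qed
  qed
  have P_closed: "closedin mtopology (P h C)" if "h \<in> S" "closedin mtopology C" for h C
    using closedin_continuous_map_preimage[OF continuous_mult[OF that(1)] that(2)] by (simp add: P_def)
  have eq: "emeasure \<nu> (P h C) = emeasure \<nu> C" if "h \<in> S" "closedin mtopology C" for h C
    using le[OF that] le[OF inv_in[OF that(1)] P_closed[OF that]] P_inv[OF that(1), of C]
      closedin_subset[OF that(2)] by auto
  have distr: "distr \<nu> \<nu> (mult h) = \<nu>" if h: "h \<in> S" for h
  proof (rule measure_eqI_generator_eq[where E = "{C. closedin mtopology C}" and \<Omega> = S and A = "\<lambda>_. S"])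
    show "Int_stable {C. closedin mtopology C}" by (auto simp: Int_stable_def)
    show "{C. closedin mtopology C} \<subseteq> Pow S" using closedin_subset by fastforce
    show "emeasure (distr \<nu> \<nu> (mult h)) C = emeasure \<nu> C" if "C \<in> {C. closedin mtopology C}" for C
      using that meas[OF h] closed_sets eq[OF h] by (simp add: emeasure_distr flip: P_vimage)
    show "emeasure (distr \<nu> \<nu> (mult h)) S \<noteq> \<infinity>"
      using meas[OF h] fin sets.top[of \<nu>] by (simp add: sp emeasure_distr emeasure_eq_measure)
    show "range (\<lambda>_::nat. S) \<subseteq> {C. closedin mtopology C}" using closedin_topspace[of mtopology] by auto
  qed (auto simp: sets sigma_sets_closed)
  have P_eq: "emeasure \<nu> (P h A) = emeasure \<nu> A" if "h \<in> S" "A \<in> sets \<nu>" for h A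
    using emeasure_distr[OF meas[OF that(1)] that(2)] distr[OF that(1)] by (simp add: P_vimage)
  have "(\<lambda>h. g \<otimes>\<^bsub>G\<^esub> h) ` A = P (inv\<^bsub>G\<^esub> g) A" if g: "g \<in> S" and A: "A \<subseteq> S" for g A
  proof (intro equalityI subsetI)
    fix x assume "x \<in> P (inv\<^bsub>G\<^esub> g) A"
    then have x: "x \<in> S" "mult (inv\<^bsub>G\<^esub> g) x \<in> A" by (auto simp: P_def)
    have "x = g \<otimes>\<^bsub>G\<^esub> (mult (inv\<^bsub>G\<^esub> g) x)"
      using mult_assoc[of g "inv\<^bsub>G\<^esub> g" x] g x by (simp add: inv_in mult_inv mult_one)
    then show "x \<in> (\<lambda>h. g \<otimes>\<^bsub>G\<^esub> h) ` A" using x by blast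
  next
    fix x assume "x \<in> (\<lambda>h. g \<otimes>\<^bsub>G\<^esub> h) ` A"
    then obtain h where "h \<in> A" "x = mult g h" by auto
    then show "x \<in> P (inv\<^bsub>G\<^esub> g) A"
      using mult_assoc[of "inv\<^bsub>G\<^esub> g" g h] g A by (auto simp: P_def inv_in mult_inv mult_one mult_in subset_iff)
  qed
  then show ?thesis
    unfolding haar_measure_def using sp sets pos fin P_eq inv_in sets.sets_into_space[of _ \<nu>] by auto
qed

end

section \<open>Injective measurable images in standard Borel spaces\<close>

text \<open>A point is coded by its distances to a dense sequence. Completeness makes the set of
  codes Borel; among codes, a ball around a point of the sequence is one coordinate inequality,
  which handles open sets; and injectivity lets images commute with complements, which carries the
  claim to all Borel sets.\<close>

lemma standard_borel_coding:
  assumes "standard_borel M"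
  obtains e :: "'a \<Rightarrow> nat \<Rightarrow> real" where
    "e \<in> borel_measurable M" "inj_on e (space M)" "\<And>A. A \<in> sets M \<Longrightarrow> e ` A \<in> sets borel"
proof (cases "space M = {}")
  case True
  then show thesis
    by (intro that[of "\<lambda>_ _. 0"]) (auto dest: sets.sets_into_space simp: measurable_def)
next
  case False
  obtain \<tau> where \<tau>: "completely_metrizable_space \<tau>" "separable_space \<tau>"
    and top: "topspace \<tau> = space M" and sets: "sets M = borel_sets_of \<tau>"
    using assms unfolding standard_borel_def by blast
  obtain X d where "Metric_space X d" and compl: "Metric_space.mcomplete X d"
    and \<tau>_eq: "\<tau> = Metric_space.mtopology X d"
    using \<tau>(1) unfolding completely_metrizable_space_def by blast
  then interpret Metric_space X d by simp
  have X: "space M = X" using top by (simp add: \<tau>_eq)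
  obtain C where C: "countable C" "C \<subseteq> X" "mtopology closure_of C = X"
    using \<tau>(2) unfolding \<tau>_eq separable_space_def by auto
  have "C \<noteq> {}" using C False X by auto
  define c where "c = from_nat_into C"
  have c_in: "c n \<in> X" for n using C \<open>C \<noteq> {}\<close> unfolding c_def by (meson from_nat_into subsetD)
  have c_dense: "\<exists>n. d x (c n) < r" if "x \<in> X" "r > 0" for x r
  proof -
    have "x \<in> mtopology closure_of C" using that C(3) by simp
    then have "\<exists>y\<in>C. y \<in> mball x r" using that(2) unfolding metric_closure_of by blast
    then obtain y where "y \<in> C" "d x y < r" by auto
    then show ?thesis using from_nat_into_surj[OF C(1)] unfolding c_def by metis
  qed
  have open_sets: "U \<in> sets M" if "openin mtopology U" for U
    using that unfolding sets borel_sets_of_def \<tau>_eq by (auto intro: sigma_sets.Basic)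
  define e where "e x n = d x (c n)" for x n
  have "(\<lambda>x. e x n) \<in> borel_measurable M" for n
    unfolding borel_measurable_iff_less
  proof
    fix a
    have "{w \<in> space M. e w n < a} = mball (c n) a"
      using c_in by (auto simp: e_def X commute)
    then show "{w \<in> space M. e w n < a} \<in> sets M" using open_sets by simp
  qed
  then have e_meas: "e \<in> borel_measurable M" by (rule measurable_coordinatewise_then_product)
  have close: "d x y \<le> e x n + e y n" if "x \<in> X" "y \<in> X" for x y n
    using triangle[OF that(1) c_in that(2)] by (simp add: e_def commute)
  have e_inj: "inj_on e (space M)"
  proof (rule inj_onI)
    fix x y assume "x \<in> space M" "y \<in> space M" and eq: "e x = e y"
    then have xy: "x \<in> X" "y \<in> X" using X by auto
    have "d x y \<le> r" if r: "r > 0" for r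
    proof -
      obtain n where "d x (c n) < r / 2" using c_dense[OF xy(1), of "r / 2"] r by auto
      then show ?thesis using close[OF xy, of n] eq by (simp add: e_def fun_eq_iff)
    qed
    then have "d x y \<le> 0" by (rule field_le_epsilon[of _ 0, simplified])
    then show "x = y" using xy nonneg[of x y] by simp
  qed
  \<comment> \<open>These are Katetov's conditions: the values \<open>u n\<close> could be the
    distances from one further point to the points \<open>c n\<close>. Values arbitrarily close to 0
    force that point into the closure of the sequence.\<close>
  define E where "E = {u :: nat \<Rightarrow> real. (\<forall>k. \<exists>n. u n < inverse (real (Suc k))) \<and>
     (\<forall>n m. \<bar>u n - u m\<bar> \<le> d (c n) (c m) \<and> d (c n) (c m) \<le> u n + u m)}"
  have [measurable]: "(\<lambda>u :: nat \<Rightarrow> real. u n) \<in> borel_measurable borel" for n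
    by (rule measurable_product_coordinates)
  have "{u \<in> space borel. (\<forall>k. \<exists>n. u n < inverse (real (Suc k))) \<and>
     (\<forall>n m. \<bar>u n - u m\<bar> \<le> d (c n) (c m) \<and> d (c n) (c m) \<le> u n + u m)} \<in> sets borel"
    by measurable
  then have E_sets: "E \<in> sets borel" by (simp add: E_def)
  text \<open>A point of \<open>E\<close> is the distance function to the limit of any Cauchy sequence of points \<open>c n\<close> along which it tends to \<open>0\<close>.\<close>
  have E: "e ` space M = E"
  proof (intro equalityI subsetI)
    fix u assume "u \<in> e ` space M"
    then obtain x where x: "x \<in> X" "u = e x" using X by auto
    have "\<bar>e x n - e x m\<bar> \<le> d (c n) (c m) \<and> d (c n) (c m) \<le> e x n + e x m" for n m
      using triangle[OF x(1) c_in[of n] c_in[of m]] triangle[OF x(1) c_in[of m] c_in[of n]]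
        triangle[OF c_in[of n] x(1) c_in[of m]] by (auto simp: e_def commute abs_le_iff)
    then show "u \<in> E" using x c_dense[OF x(1)] by (auto simp: E_def e_def)
  next
    fix u assume u: "u \<in> E"
    then have "\<forall>k. \<exists>n. u n < inverse (real (Suc k))" by (simp add: E_def)
    then obtain s where s: "\<And>k. u (s k) < inverse (real (Suc k))" by metis
    have u1: "\<bar>u n - u m\<bar> \<le> d (c n) (c m)" "d (c n) (c m) \<le> u n + u m" for n m
      using u by (auto simp: E_def)
    have u_nonneg: "0 \<le> u n" for n using u1(2)[of n n] nonneg[of "c n" "c n"] by linarith
    have u_lim: "(\<lambda>k. u (s k)) \<longlonglongrightarrow> 0"
      by (rule tendsto_sandwich[OF _ _ tendsto_const LIMSEQ_inverse_real_of_nat])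
        (use s u_nonneg in \<open>auto intro!: always_eventually less_imp_le\<close>)
    have "MCauchy (\<lambda>k. c (s k))"
      unfolding MCauchy_def
    proof (intro conjI allI impI)
      fix \<epsilon> :: real assume "\<epsilon> > 0"
      then obtain N where N: "\<And>k. k \<ge> N \<Longrightarrow> u (s k) < \<epsilon> / 2"
        using order_tendstoD(2)[OF u_lim, of "\<epsilon> / 2"] unfolding eventually_sequentially by auto
      have "d (c (s n)) (c (s n')) < \<epsilon>" if "N \<le> n" "N \<le> n'" for n n'
        using u1(2)[of "s n" "s n'"] N[OF that(1)] N[OF that(2)] by simp
      then show "\<exists>N. \<forall>n n'. N \<le> n \<longrightarrow> N \<le> n' \<longrightarrow> d (c (s n)) (c (s n')) < \<epsilon>" by blast
    qed (use c_in in auto)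
    then obtain x where "limitin mtopology (\<lambda>k. c (s k)) x sequentially"
      using compl unfolding mcomplete_def by blast
    then have x: "x \<in> X" "(\<lambda>k. d (c (s k)) x) \<longlonglongrightarrow> 0"
      unfolding limitin_metric_dist_null by auto
    have "u n = e x n" for n
    proof -
      have "\<bar>u n - d x (c n)\<bar> \<le> u (s k) + d (c (s k)) x" for k
      proof -
        have "\<bar>d (c n) (c (s k)) - d x (c n)\<bar> \<le> d (c (s k)) x"
          using triangle[OF x(1) c_in[of "s k"] c_in[of n]] triangle[OF c_in[of "s k"] x(1) c_in[of n]]
          by (auto simp: commute abs_le_iff)
        then show ?thesis using u1(1)[of n "s k"] u1(2)[of n "s k"] by linarith
      qed
      then have "\<bar>u n - d x (c n)\<bar> \<le> 0 + 0"
        by (intro LIMSEQ_le_const[OF tendsto_add[OF u_lim x(2)]]) auto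
      then show ?thesis by (simp add: e_def)
    qed
    then show "u \<in> e ` space M" using x X by auto
  qed
  have e_image: "e ` A \<in> sets borel" if "A \<in> sets M" for A
  proof -
    have "A \<in> sigma_sets X {U. openin mtopology U}"
      using that by (simp add: sets borel_sets_of_def \<tau>_eq)
    then show ?thesis
    proof induction
      case (Basic U)
      then have U: "openin mtopology U" "U \<subseteq> X" by (auto simp: openin_mtopology)
      define I where "I = {(n, k). mball (c n) (inverse (real (Suc k))) \<subseteq> U}"
      have "e ` U = E \<inter> (\<Union>(n, k)\<in>I. {u. u n < inverse (real (Suc k))})"
      proof (intro equalityI subsetI)
        fix u assume "u \<in> e ` U"
        then obtain x where x: "x \<in> U" "u = e x" by auto
        then obtain r where r: "r > 0" "mball x r \<subseteq> U" using U unfolding openin_mtopology by blast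
        then obtain k where k: "inverse (real (Suc k)) < r / 2"
          using reals_Archimedean[of "r / 2"] by auto
        obtain n where n: "d x (c n) < inverse (real (Suc k))"
          using c_dense[of x "inverse (real (Suc k))"] x U by auto
        have "mball (c n) (inverse (real (Suc k))) \<subseteq> mball x r"
          using n k x U c_in by (intro mball_subset) (auto simp: commute)
        then have "(n, k) \<in> I" using r by (auto simp: I_def)
        then show "u \<in> E \<inter> (\<Union>(n, k)\<in>I. {u. u n < inverse (real (Suc k))})"
          using n x U X E by (auto simp: e_def intro!: bexI[of _ "(n, k)"])
      next
        fix u assume "u \<in> E \<inter> (\<Union>(n, k)\<in>I. {u. u n < inverse (real (Suc k))})"
        then obtain n k where nk: "u \<in> E" "(n, k) \<in> I" "u n < inverse (real (Suc k))" by auto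
        then obtain x where x: "x \<in> X" "u = e x" using E X by auto
        then have "x \<in> mball (c n) (inverse (real (Suc k)))" using nk c_in by (simp add: e_def commute)
        then show "u \<in> e ` U" using x nk by (auto simp: I_def)
      qed
      moreover have "(\<Union>(n, k)\<in>I. {u. u n < inverse (real (Suc k))}) \<in> sets borel"
      proof -
        have "{u \<in> space borel. u n < inverse (real (Suc k))} \<in> sets borel" for n k :: nat
          by measurable
        then show ?thesis by (intro sets.countable_UN') (auto split: prod.split)
      qed
      ultimately show ?case using E_sets by simp
    next
      case (Compl A)
      have "A \<subseteq> X" using Compl.hyps by (rule sigma_sets_into_sp[rotated]) (auto simp: openin_mtopology)
      then have "e ` (X - A) = E - e ` A"
        using e_inj E X by (metis Diff_subset inj_on_image_set_diff subset_refl)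
      then show ?case using E_sets Compl by simp
    next
      case (Union A)
      then show ?case by (simp add: image_UN)
    qed simp
  qed
  show thesis using that e_meas e_inj e_image by blast
qed

text \<open>For closed B the image is compact. Injectivity of \<open>snd\<close> on K makes images
  commute with complements relative to K, so the sets B with Borel image form a
  sigma-algebra.\<close>

lemma compact_snd_image_measurable:
  fixes K :: "((nat \<Rightarrow> real) \<times> (nat \<Rightarrow> real)) set"
  assumes K: "compact K" and inj: "inj_on snd K" and B: "B \<in> sets borel"
  shows "snd ` (K \<inter> B \<times> UNIV) \<in> sets borel"
proof -
  have cpt: "snd ` (K \<inter> C \<times> UNIV) \<in> sets borel" if "closed C" for C
  proof -
    have "compact (snd ` (K \<inter> C \<times> UNIV))"
      using K that by (intro compact_continuous_image continuous_on_snd continuous_on_id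
        compact_Int_closed closed_Times) auto
    then show ?thesis by (intro borel_closed compact_imp_closed)
  qed
  have "B \<in> sigma_sets UNIV (Collect closed)"
    using B by (simp add: borel_eq_closed)
  then show ?thesis
  proof induction
    case (Compl B)
    have "snd ` (K \<inter> (UNIV - B) \<times> UNIV) = snd ` (K - K \<inter> B \<times> UNIV)"
      by (rule arg_cong[where f = "(`) snd"]) auto
    also have "\<dots> = snd ` (K \<inter> UNIV \<times> UNIV) - snd ` (K \<inter> B \<times> UNIV)"
      using inj_on_image_set_diff[OF inj, of K "K \<inter> B \<times> UNIV"] by simp
    finally have "snd ` (K \<inter> (UNIV - B) \<times> UNIV) = snd ` (K \<inter> UNIV \<times> UNIV) - snd ` (K \<inter> B \<times> UNIV)" .
    then show ?case using Compl cpt[of UNIV] by simp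
  next
    case (Union B)
    have "snd ` (K \<inter> (\<Union>i. B i) \<times> UNIV) = (\<Union>i. snd ` (K \<inter> B i \<times> UNIV))" by blast
    then show ?case using Union by simp
  qed (use cpt in auto)
qed

text \<open>
  A substitute for the Lusin--Souslin theorem: the graph of \<open>\<psi>\<close> is exhausted up to a null
  set by compact sets, and on a compact set the projection to the range of \<open>\<psi>\<close> is a homeomorphism.
\<close>

lemma injective_images_measurable_AE:
  fixes \<psi> :: "'a \<Rightarrow> nat \<Rightarrow> real"
  assumes "standard_borel M" "finite_measure M"
    and \<psi>: "\<psi> \<in> borel_measurable M" and G: "G \<in> sets M" and inj: "inj_on \<psi> G"
  obtains U where "U \<in> sets M" "U \<subseteq> G" "emeasure M (G - U) = 0"
    "\<And>A. A \<in> sets M \<Longrightarrow> A \<subseteq> U \<Longrightarrow> \<psi> ` A \<in> sets borel"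
proof -
  interpret finite_measure M by fact
  obtain e :: "'a \<Rightarrow> nat \<Rightarrow> real" where e: "e \<in> borel_measurable M" "inj_on e (space M)"
    and e_image: "\<And>A. A \<in> sets M \<Longrightarrow> e ` A \<in> sets borel"
    using standard_borel_coding[OF assms(1)] by blast
  have GM: "G \<subseteq> space M" using G sets.sets_into_space by blast
  define \<Psi> where "\<Psi> x = (e x, \<psi> x)" for x
  have \<Psi>: "\<Psi> \<in> borel_measurable M"
    unfolding \<Psi>_def using e(1) \<psi> by (rule borel_measurable_Pair)
  \<comment> \<open>This is \<psi> read on codes, with a default value outside the codes of G. Its
    preimages are built from images under \<open>e\<close> of measurable sets, so it is Borel, and
    \<Gamma> becomes the graph of a Borel map over a Borel set.\<close>
  define s where "s u = (if u \<in> e ` G then \<psi> (the_inv_into (space M) e u) else (\<lambda>_. 0))" for u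
  have s_e: "s (e x) = \<psi> x" if "x \<in> G" for x
    using that GM e(2) by (auto simp: s_def the_inv_into_f_f subset_iff)
  have s_meas: "s \<in> borel_measurable borel"
  proof (rule measurableI)
    fix B :: "(nat \<Rightarrow> real) set" assume B: "B \<in> sets borel"
    have "s -` B \<inter> space borel = e ` (\<psi> -` B \<inter> space M \<inter> G) \<union> (if (\<lambda>_. 0) \<in> B then - e ` G else {})"
    proof (intro equalityI subsetI)
      fix u assume "u \<in> s -` B \<inter> space borel"
      then show "u \<in> e ` (\<psi> -` B \<inter> space M \<inter> G) \<union> (if (\<lambda>_. 0) \<in> B then - e ` G else {})"
        using s_e GM by (cases "u \<in> e ` G") (auto simp: s_def)
    next
      fix u assume "u \<in> e ` (\<psi> -` B \<inter> space M \<inter> G) \<union> (if (\<lambda>_. 0) \<in> B then - e ` G else {})"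
      then show "u \<in> s -` B \<inter> space borel"
        using s_e by (cases "u \<in> e ` G") (auto simp: s_def split: if_splits)
    qed
    moreover have "\<psi> -` B \<inter> space M \<inter> G \<in> sets M" using \<psi> B G by (intro sets.Int measurable_sets)
    then have "e ` (\<psi> -` B \<inter> space M \<inter> G) \<in> sets borel" by (rule e_image)
    ultimately show "s -` B \<inter> space borel \<in> sets borel" using e_image[OF G] by simp
  qed simp
  define \<Gamma> where "\<Gamma> = \<Psi> ` G"
  have "\<Gamma> = {p \<in> space borel. fst p \<in> e ` G \<and> snd p = s (fst p)}"
    using s_e by (force simp: \<Gamma>_def \<Psi>_def)
  moreover have "{p \<in> space borel. fst p \<in> e ` G \<and> snd p = s (fst p)} \<in> sets (borel :: ((nat \<Rightarrow> real) \<times> (nat \<Rightarrow> real)) measure)"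
  proof -
    have 1: "fst \<in> borel_measurable (borel :: ((nat \<Rightarrow> real) \<times> (nat \<Rightarrow> real)) measure)"
      "snd \<in> borel_measurable (borel :: ((nat \<Rightarrow> real) \<times> (nat \<Rightarrow> real)) measure)"
      by (intro borel_measurable_continuous_onI continuous_on_fst continuous_on_snd continuous_on_id)+
    have "{p \<in> space borel. snd p = s (fst p)} \<in> sets (borel :: ((nat \<Rightarrow> real) \<times> (nat \<Rightarrow> real)) measure)"
      using 1 measurable_compose[OF 1(1) s_meas] by (intro measurable_equality_set)
    moreover have "fst -` (e ` G) \<inter> space borel \<in> sets (borel :: ((nat \<Rightarrow> real) \<times> (nat \<Rightarrow> real)) measure)"
      using 1(1) e_image[OF G] by (rule measurable_sets)
    moreover have "{p \<in> space borel. fst p \<in> e ` G \<and> snd p = s (fst p)} =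
      (fst -` (e ` G) \<inter> space borel) \<inter> {p \<in> space borel. snd p = s (fst p)}" by auto
    ultimately show ?thesis by (simp only: sets.Int)
  qed
  ultimately have \<Gamma>_sets: "\<Gamma> \<in> sets borel" by simp
  define \<mu> where "\<mu> = distr M borel \<Psi>"
  have \<mu>: "emeasure \<mu> B = emeasure M (\<Psi> -` B \<inter> space M)" if "B \<in> sets borel" for B
    unfolding \<mu>_def using \<Psi> that by (rule emeasure_distr)
  have "emeasure \<mu> (space \<mu>) \<noteq> \<infinity>"
    using \<mu>[of UNIV] by (simp add: \<mu>_def)
  then have "emeasure \<mu> \<Gamma> = (SUP K\<in>{K. K \<subseteq> \<Gamma> \<and> compact K}. emeasure \<mu> K)"
    using \<Gamma>_sets by (intro inner_regular) (auto simp: \<mu>_def)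
  moreover obtain f :: "nat \<Rightarrow> ennreal" where f: "range f \<subseteq> emeasure \<mu> ` {K. K \<subseteq> \<Gamma> \<and> compact K}"
    "(SUP K\<in>{K. K \<subseteq> \<Gamma> \<and> compact K}. emeasure \<mu> K) = (SUP n. f n)"
    using ennreal_SUP_countable_SUP[of "{K. K \<subseteq> \<Gamma> \<and> compact K}" "emeasure \<mu>"]
    by (metis (mono_tags, lifting) compact_empty empty_iff empty_subsetI mem_Collect_eq)
  ultimately have f_sup: "emeasure \<mu> \<Gamma> = (SUP n. f n)" by simp
  have "\<forall>n. \<exists>K. K \<subseteq> \<Gamma> \<and> compact K \<and> f n = emeasure \<mu> K" using f(1) by blast
  then obtain K where K: "\<And>n. K n \<subseteq> \<Gamma>" "\<And>n. compact (K n)" "\<And>n. f n = emeasure \<mu> (K n)" by metis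
  have K_sets: "K n \<in> sets borel" for n using compact_imp_closed[OF K(2)] by simp
  have \<Psi>_inj: "x = y" if "x \<in> space M" "y \<in> space M" "\<Psi> x = \<Psi> y" for x y
    using that e(2) by (auto simp: \<Psi>_def inj_on_def)
  define U where "U = \<Psi> -` (\<Union>n. K n) \<inter> space M"
  have U: "U \<in> sets M" unfolding U_def using \<Psi> K_sets by (intro measurable_sets[OF \<Psi>]) auto
  have UG: "U \<subseteq> G"
  proof
    fix x assume "x \<in> U"
    then have "\<Psi> x \<in> \<Gamma>" "x \<in> space M" using K(1) by (auto simp: U_def)
    then show "x \<in> G" using \<Psi>_inj GM unfolding \<Gamma>_def by (metis imageE subsetD)
  qed
  have "\<Psi> -` \<Gamma> \<inter> space M = G" using \<Psi>_inj GM unfolding \<Gamma>_def by blast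
  then have "emeasure M G = (SUP n. f n)" using f_sup \<mu>[OF \<Gamma>_sets] by simp
  also have "\<dots> \<le> emeasure \<mu> (\<Union>n. K n)"
    using K_sets K(3) by (intro SUP_least) (auto intro!: emeasure_mono simp: \<mu>_def)
  also have "\<dots> = emeasure M U" using \<mu>[of "\<Union>n. K n"] K_sets by (simp add: U_def)
  finally have "emeasure M G \<le> emeasure M U" .
  then have "emeasure M (G - U) = 0"
    using emeasure_Diff[OF _ G U UG] by (simp add: diff_eq_0_iff_ennreal less_top[symmetric])
  moreover have "\<psi> ` A \<in> sets borel" if A: "A \<in> sets M" "A \<subseteq> U" for A
  proof -
    have "\<psi> ` A = (\<Union>n. snd ` (K n \<inter> e ` A \<times> UNIV))"
    proof (intro equalityI subsetI)
      fix v assume "v \<in> \<psi> ` A"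
      then obtain x where x: "x \<in> A" "v = \<psi> x" by auto
      then obtain n where "\<Psi> x \<in> K n" using A by (auto simp: U_def)
      then show "v \<in> (\<Union>n. snd ` (K n \<inter> e ` A \<times> UNIV))" using x by (force simp: \<Psi>_def)
    next
      fix v assume "v \<in> (\<Union>n. snd ` (K n \<inter> e ` A \<times> UNIV))"
      then obtain n x w where x: "(w, v) \<in> K n" "x \<in> A" "w = e x" by auto
      then obtain y where y: "y \<in> G" "w = e y" "v = \<psi> y" using K(1)[of n] by (auto simp: \<Gamma>_def \<Psi>_def)
      have "x \<in> space M" "y \<in> space M" using x y A UG GM by auto
      then have "x = y" using x y e(2) by (auto simp: inj_on_def)
      then show "v \<in> \<psi> ` A" using x y by auto
    qed
    moreover have "snd ` (K n \<inter> e ` A \<times> UNIV) \<in> sets borel" for n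
    proof (rule compact_snd_image_measurable[OF K(2) _ e_image[OF A(1)]])
      show "inj_on snd (K n)"
      proof (rule inj_onI)
        fix p q assume "p \<in> K n" "q \<in> K n" and eq: "snd p = snd q"
        then obtain x y where xy: "x \<in> G" "p = \<Psi> x" "y \<in> G" "q = \<Psi> y"
          using K(1)[of n] unfolding \<Gamma>_def by blast
        then have "x = y" using inj_onD[OF inj] eq by (simp add: \<Psi>_def)
        then show "p = q" using xy by simp
      qed
    qed
    ultimately show ?thesis by auto
  qed
  ultimately show thesis using that U UG by blast
qed

section \<open>Ergodic systems that are not sensitive\<close>

context finite_mp_system
begin

lemma T_in: "x \<in> space M \<Longrightarrow> T x \<in> space M"
  using measurable_T by (rule measurable_space)

lemma measurable_T_pow: "T ^^ n \<in> measurable M M"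
proof (induction n)
  case (Suc n)
  then show ?case using measurable_comp[OF Suc measurable_T] by (simp add: o_def)
qed (simp add: id_def)

lemma T_pow_in: "x \<in> space M \<Longrightarrow> (T ^^ n) x \<in> space M"
  using measurable_T_pow by (rule measurable_space)

lemma preserving_T_pow:
  assumes "A \<in> sets M" shows "emeasure M ((T ^^ n) -` A \<inter> space M) = emeasure M A"
proof (induction n)
  case 0
  then show ?case using sets.sets_into_space[OF assms] by (simp add: Int_absorb2)
next
  case (Suc n)
  have "(T ^^ Suc n) -` A \<inter> space M = T -` ((T ^^ n) -` A \<inter> space M) \<inter> space M"
    using T_in by (auto simp: funpow_Suc_right simp del: funpow.simps)
  then show ?case
    using Suc preserving[OF measurable_sets[OF measurable_T_pow[of n] assms]] by (simp only:)
qed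

lemma distr_T: "distr M M T = M"
  by (rule measure_eqI) (auto simp: emeasure_distr measurable_T preserving)

text \<open>Ergodicity speaks of sets equal to their preimage. The preimages of W under the iterates
  increase, all with the measure of W, so their union is such a set and has the same measure as
  W.\<close>

lemma ergodic_forward:
  assumes erg: "ergodic M T" and W: "W \<in> sets M" and fwd: "\<And>x. x \<in> W \<Longrightarrow> T x \<in> W"
  shows "emeasure M W = 0 \<or> emeasure M (space M - W) = 0"
proof -
  define A where "A n = (T ^^ n) -` W \<inter> space M" for n
  have A: "A n \<in> sets M" "emeasure M (A n) = emeasure M W" for n
    unfolding A_def using measurable_sets[OF measurable_T_pow W] preserving_T_pow[OF W] by auto
  have "incseq A"
    by (rule incseq_SucI) (auto simp: A_def fwd)
  define V where "V = (\<Union>n. A n)"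
  have V: "V \<in> sets M" unfolding V_def using A by auto
  have "emeasure M V = (SUP n. emeasure M (A n))"
    unfolding V_def using A \<open>incseq A\<close> by (intro SUP_emeasure_incseq[symmetric]) auto
  then have VW: "emeasure M V = emeasure M W" by (simp add: A)
  have TA: "T -` A n \<inter> space M = A (Suc n)" for n
    using T_in by (auto simp: A_def funpow_Suc_right simp del: funpow.simps)
  have "T -` V \<inter> space M = (\<Union>n. A (Suc n))"
    unfolding V_def using TA by blast
  also have "\<dots> = V" using incseq_SucD[OF \<open>incseq A\<close>] unfolding V_def by blast
  finally have "emeasure M V = 0 \<or> emeasure M (space M - V) = 0"
    using erg V unfolding ergodic_def by blast
  then show ?thesis
    using VW V W by (simp add: emeasure_compl)
qed

text \<open>Points that never visit A form a forward-invariant set; it cannot be conull, since its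
  complement contains A.\<close>

lemma ergodic_visits:
  assumes erg: "ergodic M T" and A: "A \<in> sets M" and pos: "0 < emeasure M A"
  shows "AE x in M. \<exists>n. (T ^^ n) x \<in> A"
proof -
  define W where "W = {x \<in> space M. \<forall>n. (T ^^ n) x \<notin> A}"
  have vis: "(T ^^ n) -` A \<inter> space M \<in> sets M" for n
    using measurable_sets[OF measurable_T_pow A] .
  have W_eq: "W = space M - (\<Union>n. (T ^^ n) -` A \<inter> space M)" by (auto simp: W_def)
  have W: "W \<in> sets M"
    unfolding W_eq using vis by (intro sets.Diff sets.top sets.countable_UN) auto
  have "T x \<in> W" if "x \<in> W" for x
  proof -
    have "(T ^^ n) (T x) \<notin> A" for n
      using that unfolding W_def by (metis (mono_tags, lifting) comp_apply funpow_Suc_right mem_Collect_eq)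
    then show ?thesis using that T_in by (auto simp: W_def)
  qed
  then have "emeasure M W = 0 \<or> emeasure M (space M - W) = 0"
    using ergodic_forward[OF erg W] by blast
  moreover have "emeasure M (space M - W) \<noteq> 0"
  proof -
    have "A \<subseteq> space M - W"
    proof
      fix x assume "x \<in> A"
      then have "(T ^^ 0) x \<in> A" "x \<in> space M" using sets.sets_into_space[OF A] by auto
      then show "x \<in> space M - W" unfolding W_def by blast
    qed
    then have "emeasure M A \<le> emeasure M (space M - W)" using W by (intro emeasure_mono) auto
    then show ?thesis using pos by auto
  qed
  ultimately have "W \<in> null_sets M" using W by auto
  then show ?thesis by (rule AE_I') (auto simp: W_def)
qed

lemma AE_ex_in:
  assumes "AE x in M. P x" "A \<in> sets M" "0 < emeasure M A"
  shows "\<exists>x\<in>A. P x"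
proof (rule ccontr)
  assume "\<not> (\<exists>x\<in>A. P x)"
  then have "AE x in M. x \<notin> A" using assms(1) by (auto elim: eventually_mono)
  then have "emeasure M A = 0" using assms(2) by (simp add: AE_iff_null_sets null_setsD1)
  then show False using assms(3) by simp
qed

end

section \<open>The supremum metric and the support of the measure\<close>

locale insensitive_system = finite_mp_system +
  fixes d :: "'a \<Rightarrow> 'a \<Rightarrow> real"
  assumes erg: "ergodic M T" and compat: "compatible_metric M d"
    and insensitive: "\<not> W_sensitive_wrt M T d"
begin

text \<open>The truncation only matters outside \<open>space M\<close>, where \<open>d\<close> need not be bounded.\<close>

definition D :: "'a \<Rightarrow> 'a \<Rightarrow> real" where
  "D x y = (SUP n. min 1 (d ((T ^^ n) x) ((T ^^ n) y)))"

sublocale Md: Metric_space "space M" d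
  using compat unfolding compatible_metric_def by blast

sublocale MM: pair_sigma_finite M M ..

lemma d_le_1: "x \<in> space M \<Longrightarrow> y \<in> space M \<Longrightarrow> d x y \<le> 1"
  using compat unfolding compatible_metric_def by blast

lemma bdd_d: "bdd_above (range (\<lambda>n. min 1 (d ((T ^^ n) x) ((T ^^ n) y))))"
  by (intro bdd_aboveI[of _ 1]) auto

lemma d_le_D:
  assumes "x \<in> space M" "y \<in> space M"
  shows "d ((T ^^ n) x) ((T ^^ n) y) \<le> D x y"
proof -
  have "min 1 (d ((T ^^ n) x) ((T ^^ n) y)) \<le> D x y"
    unfolding D_def using bdd_d by (intro cSUP_upper) auto
  then show ?thesis using d_le_1[OF T_pow_in[OF assms(1)] T_pow_in[OF assms(2)], of n n] by simp
qed

lemma D_least: "(\<And>n. d ((T ^^ n) x) ((T ^^ n) y) \<le> c) \<Longrightarrow> D x y \<le> c"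
  unfolding D_def by (rule cSUP_least) (auto intro: min.coboundedI2)

lemma D_le_1: "D x y \<le> 1"
  unfolding D_def by (rule cSUP_least) auto

sublocale MD: Metric_space "space M" D
proof
  show D_nonneg: "0 \<le> D x y" for x y
  proof -
    have "0 \<le> min 1 (d ((T ^^ 0) x) ((T ^^ 0) y))" using Md.nonneg by simp
    also have "\<dots> \<le> D x y" unfolding D_def using bdd_d by (intro cSUP_upper) auto
    finally show ?thesis .
  qed
  show "D x y = D y x" for x y by (simp add: D_def Md.commute)
  fix x y assume xy: "x \<in> space M" "y \<in> space M"
  show "D x y = 0 \<longleftrightarrow> x = y"
  proof
    assume "D x y = 0"
    then have "d x y \<le> 0" using d_le_D[OF xy, of 0] by simp
    then show "x = y" using xy Md.nonneg[of x y] by simp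
  next
    assume "x = y"
    then have "D x y \<le> 0" using T_pow_in xy by (intro D_least) simp
    then show "D x y = 0" using D_nonneg[of x y] by simp
  qed
  fix z assume z: "z \<in> space M"
  show "D x z \<le> D x y + D y z"
  proof (rule D_least)
    fix n
    have "d ((T ^^ n) x) ((T ^^ n) z) \<le> d ((T ^^ n) x) ((T ^^ n) y) + d ((T ^^ n) y) ((T ^^ n) z)"
      using xy z T_pow_in by (intro Md.triangle) auto
    also have "\<dots> \<le> D x y + D y z" using xy z by (intro add_mono d_le_D) auto
    finally show "d ((T ^^ n) x) ((T ^^ n) z) \<le> D x y + D y z" .
  qed
qed

lemma D_T_le: "x \<in> space M \<Longrightarrow> y \<in> space M \<Longrightarrow> D (T x) (T y) \<le> D x y"
  using d_le_D[of x y "Suc _"] by (intro D_least) (simp add: funpow_Suc_right del: funpow.simps)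

lemma D_T_pow_le: "x \<in> space M \<Longrightarrow> y \<in> space M \<Longrightarrow> D ((T ^^ n) x) ((T ^^ n) y) \<le> D x y"
proof (induction n)
  case (Suc n)
  then show ?case using D_T_le[of "(T ^^ n) x" "(T ^^ n) y"] T_pow_in by fastforce
qed simp

lemma measurable_D_pair [measurable]: "(\<lambda>p. D (fst p) (snd p)) \<in> borel_measurable (M \<Otimes>\<^sub>M M)"
proof -
  have d: "(\<lambda>p. d (fst p) (snd p)) \<in> borel_measurable (M \<Otimes>\<^sub>M M)"
    using compat unfolding compatible_metric_def by (simp add: case_prod_beta')
  have [measurable]: "(\<lambda>p. d ((T ^^ n) (fst p)) ((T ^^ n) (snd p))) \<in> borel_measurable (M \<Otimes>\<^sub>M M)" for n
  proof -
    have "(\<lambda>p. ((T ^^ n) (fst p), (T ^^ n) (snd p))) \<in> measurable (M \<Otimes>\<^sub>M M) (M \<Otimes>\<^sub>M M)"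
      by (intro measurable_Pair measurable_compose[OF _ measurable_T_pow]) auto
    from measurable_compose[OF this d] show ?thesis by simp
  qed
  show ?thesis
    unfolding D_def by (intro borel_measurable_cSUP bdd_d) auto
qed

lemma measurable_D [measurable (raw)]:
  assumes "f \<in> measurable N M" "g \<in> measurable N M"
  shows "(\<lambda>x. D (f x) (g x)) \<in> borel_measurable N"
  using measurable_compose[OF measurable_Pair[OF assms] measurable_D_pair] by simp

lemma measurable_D1: "x \<in> space M \<Longrightarrow> D x \<in> borel_measurable M"
  by (rule measurable_D[OF measurable_const measurable_ident_sets[OF refl]])

definition ball :: "'a \<Rightarrow> real \<Rightarrow> 'a set" where
  "ball x r = {y \<in> space M. D x y < r}"

lemma ball_sets: "x \<in> space M \<Longrightarrow> ball x r \<in> sets M"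
  using measurable_D1[of x] unfolding ball_def borel_measurable_iff_less by blast

lemma ball_mono: "r \<le> s \<Longrightarrow> ball x r \<subseteq> ball x s"
  by (auto simp: ball_def)

lemma ball_T: "x \<in> space M \<Longrightarrow> ball x r \<subseteq> (T ^^ n) -` ball ((T ^^ n) x) r \<inter> space M"
  using D_T_pow_le[of x _ n] T_pow_in by (fastforce simp: ball_def)

text \<open>Since \<open>D\<close> does not grow, a ball lies in the preimage of the equally large
  ball around the image of its centre. This monotonicity along orbits gives the forward invariance
  of \<open>Good\<close> and later bounds the number of separated orbit points.\<close>

lemma ball_measure_T:
  assumes "x \<in> space M" shows "emeasure M (ball x r) \<le> emeasure M (ball ((T ^^ n) x) r)"
proof -
  have "ball ((T ^^ n) x) r \<in> sets M" using ball_sets T_pow_in assms by simp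
  then show ?thesis
    using emeasure_mono[OF ball_T[OF assms, of r n] measurable_sets[OF measurable_T_pow]]
      preserving_T_pow by simp
qed

text \<open>If all \<epsilon>-balls were null, so would be their preimages, and almost every y would
  have each iterate at \<open>D\<close>-distance at least \<epsilon> from that of x. As
  \<open>D\<close> at time n is a supremum over the tail from n on, every tail would contain a large
  distance, and the limsup would exceed the constant \<delta> at which x violates
  sensitivity.\<close>

lemma positive_ball_ex:
  assumes "\<epsilon> > 0" shows "\<exists>x\<in>space M. 0 < emeasure M (ball x \<epsilon>)"
proof -
  \<comment> \<open>A third leaves room twice: a supremum of at least \<open>3 * \<delta>\<close>
    yields single terms of at least \<open>2 * \<delta>\<close>, and a limsup of at least
    \<open>2 * \<delta>\<close> is strictly above \<delta>.\<close>
  define \<delta> where "\<delta> = \<epsilon> / 3"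
  have \<delta>: "\<delta> > 0" using assms by (simp add: \<delta>_def)
  then obtain x where x: "x \<in> space M"
    and nAE: "\<not> (AE y in M. limsup (\<lambda>n. ereal (d ((T ^^ n) x) ((T ^^ n) y))) > ereal \<delta>)"
    using insensitive unfolding W_sensitive_wrt_def by blast
  show ?thesis
  proof (rule ccontr)
    assume "\<not> ?thesis"
    then have null: "emeasure M (ball y \<epsilon>) = 0" if "y \<in> space M" for y
      using that by (auto simp: not_gr_zero)
    have "AE y in M. (T ^^ n) y \<notin> ball ((T ^^ n) x) \<epsilon>" for n
    proof (rule AE_I'[where N = "(T ^^ n) -` ball ((T ^^ n) x) \<epsilon> \<inter> space M"])
      have b: "ball ((T ^^ n) x) \<epsilon> \<in> sets M" using ball_sets T_pow_in x by simp
      show "(T ^^ n) -` ball ((T ^^ n) x) \<epsilon> \<inter> space M \<in> null_sets M"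
        using preserving_T_pow[OF b] null[OF T_pow_in[OF x]] measurable_sets[OF measurable_T_pow b]
        by auto
    qed auto
    then have "AE y in M. \<forall>n. (T ^^ n) y \<notin> ball ((T ^^ n) x) \<epsilon>"
      by (simp add: AE_all_countable)
    then have "AE y in M. limsup (\<lambda>n. ereal (d ((T ^^ n) x) ((T ^^ n) y))) > ereal \<delta>"
      using AE_space
    proof eventually_elim
      case (elim y)
      have "\<exists>m\<ge>n. 2 * \<delta> \<le> d ((T ^^ m) x) ((T ^^ m) y)" for n
      proof (rule ccontr)
        assume "\<not> ?thesis"
        then have small: "d ((T ^^ m) x) ((T ^^ m) y) \<le> 2 * \<delta>" if "m \<ge> n" for m
          using that by force
        have "D ((T ^^ n) x) ((T ^^ n) y) \<le> 2 * \<delta>"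
          using small[of "_ + n"] by (intro D_least) (simp add: funpow_add)
        then have "(T ^^ n) y \<in> ball ((T ^^ n) x) \<epsilon>"
          using assms elim(2) T_pow_in by (simp add: ball_def \<delta>_def)
        then show False using elim(1) by blast
      qed
      then have sup: "ereal (2 * \<delta>) \<le> (SUP m\<in>{n..}. ereal (d ((T ^^ m) x) ((T ^^ m) y)))" for n
        using SUP_upper2[of _ "{n..}"] by (meson atLeast_iff ereal_less_eq(3))
      then have "ereal (2 * \<delta>) \<le> limsup (\<lambda>n. ereal (d ((T ^^ n) x) ((T ^^ n) y)))"
        unfolding limsup_INF_SUP by (intro INF_greatest sup)
      moreover have "ereal \<delta> < ereal (2 * \<delta>)" using \<delta> by simp
      ultimately show ?case by order
    qed
    then show False using nAE by blast
  qed
qed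

text \<open>This is the support of the measure for the metric \<open>D\<close>. Taking radii from a
  sequence makes it a countable intersection of measurable sets.\<close>

definition Good :: "'a set" where
  "Good = {x \<in> space M. \<forall>k. 0 < emeasure M (ball x (inverse (real (Suc k))))}"

lemma measurable_ball_measure: "(\<lambda>x. emeasure M (ball x r)) \<in> borel_measurable M"
proof -
  have "{p \<in> space (M \<Otimes>\<^sub>M M). D (fst p) (snd p) < r} \<in> sets (M \<Otimes>\<^sub>M M)" by measurable
  from MM.measurable_emeasure_Pair1[OF this] 
  show ?thesis
    by (rule measurable_cong[THEN iffD1, rotated])
      (auto simp: ball_def space_pair_measure intro!: arg_cong[where f = "emeasure M"])
qed

text \<open>For each radius r the points with positive r-ball form a forward-invariant set, as ball
  measures do not decrease along orbits. By the triangle inequality it contains a positive ball of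
  radius \<open>r / 2\<close>, so ergodicity makes it conull.\<close>

lemma Good_conull: "Good \<in> sets M" "emeasure M (space M - Good) = 0"
proof -
  define A where "A k = {x \<in> space M. 0 < emeasure M (ball x (inverse (real (Suc k))))}" for k
  have A: "A k \<in> sets M" for k
  proof -
    have [measurable]: "(\<lambda>x. emeasure M (ball x (inverse (real (Suc k))))) \<in> borel_measurable M"
      by (rule measurable_ball_measure)
    show ?thesis unfolding A_def by measurable
  qed
  have Good_eq: "Good = (\<Inter>k. A k)" by (auto simp: Good_def A_def)
  then show "Good \<in> sets M" using A by auto
  have null: "emeasure M (space M - A k) = 0" for k
  proof -
    define r where "r = inverse (real (Suc k))"
    have "r > 0" by (simp add: r_def)
    obtain z where z: "z \<in> space M" "0 < emeasure M (ball z (r / 2))"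
      using positive_ball_ex[of "r / 2"] \<open>r > 0\<close> by auto
    have "ball z (r / 2) \<subseteq> A k"
    proof
      fix x assume "x \<in> ball z (r / 2)"
      then have x: "x \<in> space M" "D z x < r / 2" by (auto simp: ball_def)
      have "ball z (r / 2) \<subseteq> ball x r"
      proof
        fix y assume "y \<in> ball z (r / 2)"
        then have y: "y \<in> space M" "D z y < r / 2" by (auto simp: ball_def)
        then show "y \<in> ball x r"
          using MD.triangle[OF x(1) z(1) y(1)] x MD.commute[of x z] by (simp add: ball_def)
      qed
      then have "emeasure M (ball z (r / 2)) \<le> emeasure M (ball x r)"
        using ball_sets[OF x(1)] by (rule emeasure_mono)
      then show "x \<in> A k" using x z unfolding A_def r_def[symmetric] by auto
    qed
    then have "emeasure M (ball z (r / 2)) \<le> emeasure M (A k)" using A by (rule emeasure_mono)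
    then have "emeasure M (A k) \<noteq> 0" using z by auto
    moreover have "T x \<in> A k" if "x \<in> A k" for x
      using ball_measure_T[of x "inverse (real (Suc k))" 1] that T_in unfolding A_def
      by (auto intro: order.strict_trans2)
    ultimately show ?thesis using ergodic_forward[OF erg A] by blast
  qed
  have "(\<Union>k. space M - A k) \<in> null_sets M"
    using A null by (intro null_sets_UN) auto
  moreover have "space M - Good = (\<Union>k. space M - A k)" by (auto simp: Good_eq)
  ultimately show "emeasure M (space M - Good) = 0" by auto
qed

lemma Good_subset: "Good \<subseteq> space M"
  by (auto simp: Good_def)

lemma AE_Good: "AE x in M. x \<in> Good"
  using Good_conull by (intro AE_I'[of "space M - Good"]) auto

lemma T_Good: "x \<in> Good \<Longrightarrow> T x \<in> Good"
  using ball_measure_T[of x _ 1] T_in unfolding Good_def by (auto intro: order.strict_trans2)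

lemma T_pow_Good: "x \<in> Good \<Longrightarrow> (T ^^ n) x \<in> Good"
  by (induction n) (auto intro: T_Good)

lemma ball_Good_pos:
  assumes "x \<in> Good" "r > 0" shows "0 < emeasure M (ball x r)"
proof -
  obtain k where "inverse (real (Suc k)) < r" using reals_Archimedean assms(2) by blast
  then have "emeasure M (ball x (inverse (real (Suc k)))) \<le> emeasure M (ball x r)"
    using ball_sets assms(1) Good_subset by (intro emeasure_mono ball_mono) auto
  then show ?thesis using assms(1) by (auto simp: Good_def intro: order.strict_trans2)
qed

text \<open>\<open>T \<times> T\<close> preserves the integral of \<open>D\<close> and does not increase \<open>D\<close>, so it preserves \<open>D\<close> almost everywhere.\<close>

lemma D_T_AE: "AE x in M. AE y in M. D (T x) (T y) = D x y"
proof -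
  note [measurable] = measurable_T
  have "(\<integral>\<^sup>+ x. \<integral>\<^sup>+ y. ennreal (D (T x) (T y)) \<partial>M \<partial>M) = (\<integral>\<^sup>+ x. \<integral>\<^sup>+ y. ennreal (D (T x) y) \<partial>M \<partial>M)"
  proof (rule nn_integral_cong)
    fix x assume x: "x \<in> space M"
    have "(\<integral>\<^sup>+ y. ennreal (D (T x) y) \<partial>distr M M T) = (\<integral>\<^sup>+ y. ennreal (D (T x) (T y)) \<partial>M)"
      using T_in[OF x] by (intro nn_integral_distr) (auto intro!: measurable_D1)
    then show "(\<integral>\<^sup>+ y. ennreal (D (T x) (T y)) \<partial>M) = (\<integral>\<^sup>+ y. ennreal (D (T x) y) \<partial>M)"
      by (simp add: distr_T)
  qed
  also have "\<dots> = (\<integral>\<^sup>+ x. \<integral>\<^sup>+ y. ennreal (D x y) \<partial>M \<partial>distr M M T)"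
    by (intro nn_integral_distr[symmetric] borel_measurable_nn_integral) measurable
  also have "\<dots> = (\<integral>\<^sup>+ x. \<integral>\<^sup>+ y. ennreal (D x y) \<partial>M \<partial>M)" by (simp add: distr_T)
  finally have eq: "(\<integral>\<^sup>+ p. ennreal (D (T (fst p)) (T (snd p))) \<partial>(M \<Otimes>\<^sub>M M)) = (\<integral>\<^sup>+ p. ennreal (D (fst p) (snd p)) \<partial>(M \<Otimes>\<^sub>M M))"
    by (simp add: nn_integral_fst[symmetric])
  have le: "D (T (fst p)) (T (snd p)) \<le> D (fst p) (snd p)" if "p \<in> space (M \<Otimes>\<^sub>M M)" for p
    using that D_T_le by (auto simp: space_pair_measure)
  have "(\<integral>\<^sup>+ p. ennreal (D (fst p) (snd p)) \<partial>(M \<Otimes>\<^sub>M M)) \<le> (\<integral>\<^sup>+ p. 1 \<partial>(M \<Otimes>\<^sub>M M))"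
    using D_le_1 by (intro nn_integral_mono) simp
  also have "\<dots> < \<infinity>"
    by (simp add: space_pair_measure emeasure_pair_measure_Times emeasure_eq_measure ennreal_mult_less_top)
  \<comment> \<open>Finiteness allows the two equal integrals to be subtracted, leaving a
    nonnegative difference with integral 0.\<close>
  finally have fin: "(\<integral>\<^sup>+ p. ennreal (D (fst p) (snd p)) \<partial>(M \<Otimes>\<^sub>M M)) \<noteq> \<infinity>" by simp
  have "(\<integral>\<^sup>+ p. ennreal (D (fst p) (snd p)) - ennreal (D (T (fst p)) (T (snd p))) \<partial>(M \<Otimes>\<^sub>M M)) = 0"
    using eq fin le by (subst nn_integral_diff) (auto simp: ennreal_leI)
  then have "AE p in M \<Otimes>\<^sub>M M. ennreal (D (fst p) (snd p)) - ennreal (D (T (fst p)) (T (snd p))) = 0"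
    by (subst (asm) nn_integral_0_iff_AE) measurable
  then have "AE p in M \<Otimes>\<^sub>M M. D (T (fst p)) (T (snd p)) = D (fst p) (snd p)"
    using AE_space
  proof eventually_elim
    case (elim p)
    then show ?case using le[OF elim(2)] by (simp add: ennreal_minus)
  qed
  from MM.AE_pair[OF this] show ?thesis by simp
qed

text \<open>Equality is known for almost all pairs and must be carried to all pairs in
  \<open>Good\<close>. Balls around such points have positive measure, so there are arbitrarily
  close pairs with equality, and \<open>T\<close> does not increase the error.\<close>

lemma D_T: assumes x: "x \<in> Good" and y: "y \<in> Good" shows "D (T x) (T y) = D x y"
proof (rule antisym)
  have xy: "x \<in> space M" "y \<in> space M" using x y Good_subset by auto
  show "D (T x) (T y) \<le> D x y" using xy by (rule D_T_le)
  show "D x y \<le> D (T x) (T y)"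
  proof (rule field_le_epsilon)
    fix e :: real assume "e > 0"
    \<comment> \<open>Four errors occur: x and y are both perturbed, before and after applying
      \<open>T\<close>.\<close>
    then have e: "e / 4 > 0" by simp
    obtain x' where x': "x' \<in> ball x (e / 4)" "AE y' in M. D (T x') (T y') = D x' y'"
      using AE_ex_in[OF D_T_AE ball_sets[OF xy(1)] ball_Good_pos[OF x e]] by blast
    obtain y' where y': "y' \<in> ball y (e / 4)" "D (T x') (T y') = D x' y'"
      using AE_ex_in[OF x'(2) ball_sets[OF xy(2)] ball_Good_pos[OF y e]] by blast
    have b: "x' \<in> space M" "y' \<in> space M" "D x x' < e / 4" "D y y' < e / 4"
      using x' y' by (auto simp: ball_def)
    have "D x y \<le> D x x' + D x' y' + D y y'"
      using MD.triangle[OF xy(1) b(1) xy(2)] MD.triangle[OF b(1,2) xy(2)] MD.commute[of y] by simp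
    moreover have "D (T x') (T y') \<le> D (T x) (T x') + D (T x) (T y) + D (T y) (T y')"
      using MD.triangle[of "T x'" "T x" "T y'"] MD.triangle[of "T x" "T y" "T y'"] MD.commute[of "T x'"]
        xy b T_in by simp
    moreover have "D (T x) (T x') \<le> D x x'" "D (T y) (T y') \<le> D y y'" using xy b D_T_le by auto
    ultimately show "D x y \<le> D (T x) (T y) + e" using y'(2) b by linarith
  qed
qed

lemma D_T_pow: "x \<in> Good \<Longrightarrow> y \<in> Good \<Longrightarrow> D ((T ^^ n) x) ((T ^^ n) y) = D x y"
  by (induction n) (auto simp: D_T T_pow_Good)

text \<open>For fixed y almost every orbit comes close to y, but the exceptional set depends on y.
  Fubini exchanges the quantifiers and gives one x that works for almost every y; since balls around
  points of \<open>Good\<close> have positive measure, every y in \<open>Good\<close> has a point z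
  nearby for which x works.\<close>

lemma dense_orbit_ex: "\<exists>x\<in>Good. \<forall>y\<in>Good. \<forall>\<epsilon>>0. \<exists>n. D ((T ^^ n) x) y < \<epsilon>"
proof -
  note [measurable] = measurable_T_pow
  define P where "P x y \<longleftrightarrow> (\<forall>k. \<exists>n. D ((T ^^ n) x) y < inverse (real (Suc k)))" for x y
  have "AE x in M. P x y" if "y \<in> Good" for y
    unfolding P_def AE_all_countable
  proof
    fix k
    have "AE x in M. \<exists>n. (T ^^ n) x \<in> ball y (inverse (real (Suc k)))"
      using that Good_subset by (intro ergodic_visits[OF erg] ball_sets ball_Good_pos) auto
    then show "AE x in M. \<exists>n. D ((T ^^ n) x) y < inverse (real (Suc k))"
      by eventually_elim (auto simp: ball_def MD.commute)
  qed
  then have "AE y in M. AE x in M. P x y" using AE_Good by (auto elim: eventually_mono)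
  moreover have "{p \<in> space (M \<Otimes>\<^sub>M M). P (fst p) (snd p)} \<in> sets (M \<Otimes>\<^sub>M M)"
    unfolding P_def by measurable
  ultimately have "AE x in M. AE y in M. P x y" using MM.AE_commute by blast
  then have "AE x in M. x \<in> Good \<and> (AE y in M. P x y)" using AE_Good by eventually_elim simp
  then obtain x where x: "x \<in> Good" "AE y in M. P x y"
    using AE_ex_in[OF _ sets.top positive_mass] by blast
  have "\<exists>n. D ((T ^^ n) x) y < \<epsilon>" if y: "y \<in> Good" and \<epsilon>: "\<epsilon> > 0" for y \<epsilon>
  proof -
    have yM: "y \<in> space M" and xM: "x \<in> space M" using x y Good_subset by auto
    obtain z where z: "z \<in> ball y (\<epsilon> / 2)" "P x z"
      using AE_ex_in[OF x(2) ball_sets[OF yM] ball_Good_pos[OF y]] \<epsilon> half_gt_zero by meson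
    obtain k where "inverse (real (Suc k)) < \<epsilon> / 2"
      using reals_Archimedean[of "\<epsilon> / 2"] \<epsilon> by auto
    then obtain n where n: "D ((T ^^ n) x) z < \<epsilon> / 2"
      using z(2) unfolding P_def by (meson order.strict_trans)
    have "D ((T ^^ n) x) y < \<epsilon>"
      using MD.triangle[OF T_pow_in[OF xM], of z y n] n z(1) yM MD.commute[of z y] by (simp add: ball_def)
    then show ?thesis by blast
  qed
  then show ?thesis using x by blast
qed

text \<open>Measurability comes from \<open>D\<close>: the singleton is the set where
  \<open>D x\<close> is at most 0. A point mass has no subset of intermediate measure.\<close>

lemma singleton_null: assumes "x \<in> space M" shows "{x} \<in> sets M" "emeasure M {x} = 0"
proof -
  have "{y \<in> space M. D x y \<le> 0} \<in> sets M"
    using measurable_D1[OF assms] unfolding borel_measurable_iff_le by blast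
  moreover have "{y \<in> space M. D x y \<le> 0} = {x}"
    using assms MD.nonneg by (auto simp: order.antisym dest: antisym)
  ultimately show x: "{x} \<in> sets M" by simp
  show "emeasure M {x} = 0"
  proof (rule ccontr)
    assume "emeasure M {x} \<noteq> 0"
    then obtain B where "B \<subseteq> {x}" "0 < emeasure M B" "emeasure M B < emeasure M {x}"
      using nonatomic x unfolding Defs.nonatomic_def by (metis not_gr_zero)
    then show False by (auto simp: subset_singleton_iff)
  qed
qed

end

section \<open>Infinitude, injectivity and total boundedness of a dense orbit\<close>

locale dense_orbit = insensitive_system +
  fixes x0
  assumes x0: "x0 \<in> Good" and dense: "\<lbrakk>y \<in> Good; \<epsilon> > 0\<rbrakk> \<Longrightarrow> \<exists>n. D ((T ^^ n) x0) y < \<epsilon>"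
begin

abbreviation orb :: "nat \<Rightarrow> 'a" where
  "orb n \<equiv> (T ^^ n) x0"

lemma orb_Good: "orb n \<in> Good"
  using T_pow_Good x0 by simp

lemma orb_in: "orb n \<in> space M"
  using orb_Good Good_subset by blast

text \<open>A finite orbit would be null, so \<open>Good\<close> would contain a point outside it;
  the positive distance of that point to the finitely many orbit points contradicts density.\<close>

lemma infinite_orb: "infinite (range orb)"
proof
  assume fin: "finite (range orb)"
  have "emeasure M (range orb) = 0"
    using fin singleton_null orb_in by (subst emeasure_eq_sum_singleton) auto
  then have "emeasure M Good \<noteq> emeasure M (range orb)"
    using Good_conull positive_mass by (auto simp: emeasure_compl)
  moreover have "range orb \<subseteq> Good" using orb_Good by auto
  ultimately obtain y where y: "y \<in> Good" "y \<notin> range orb" by (metis subset_antisym subsetI)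
  define r where "r = Min ((\<lambda>z. D z y) ` range orb)"
  have "D z y > 0" if z: "z \<in> range orb" for z
  proof -
    obtain n where n: "z = orb n" using z by blast
    have "y \<in> space M" "z \<noteq> y" using y Good_subset z by auto
    then show ?thesis using MD.mdist_pos_eq[OF orb_in[of n]] n by simp
  qed
  then have "r > 0" using fin unfolding r_def by (subst Min_gr_iff) auto
  then obtain n where "D (orb n) y < r" using dense y by blast
  then show False using fin unfolding r_def by (subst (asm) Min_gr_iff) auto
qed

text \<open>A repetition \<open>orb n = orb m\<close> with \<open>n < m\<close> folds every later
  index back below m, which would make the orbit finite.\<close>

lemma inj_orb: "inj orb"
proof (rule ccontr)
  assume "\<not> inj orb"
  then obtain i j where "orb i = orb j" "i \<noteq> j" unfolding inj_def by blast
  then obtain n m where nm: "n < m" "orb n = orb m" by (metis nat_neq_iff)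
  have "orb k \<in> orb ` {..<m}" for k
  proof (induction k rule: less_induct)
    case (less k)
    show ?case
    proof (cases "k < m")
      case False
      then have "orb k = (T ^^ (k - m + m)) x0" by simp
      also have "\<dots> = (T ^^ (k - m)) (orb m)" by (simp only: funpow_add comp_apply)
      also have "\<dots> = orb (k - m + n)" using nm by (simp add: funpow_add)
      finally show ?thesis using less[of "k - m + n"] nm False by simp
    qed simp
  qed
  then have "range orb \<subseteq> orb ` {..<m}" by blast
  then have "finite (range orb)" by (rule finite_subset) simp
  then show False using infinite_orb by blast
qed

text \<open>Without a finite net, separated sets of orbit points of every size can be built
  greedily. The balls of half the radius around them are disjoint, and each has at least the measure
  c of the ball around \<open>x0\<close>, which the finite total mass forbids.\<close>

lemma orb_totally_bounded:
  assumes "\<epsilon> > 0" shows "\<exists>K. finite K \<and> (\<forall>n. \<exists>k\<in>K. D (orb k) (orb n) < \<epsilon>)"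
proof (rule ccontr)
  assume contr: "\<not> ?thesis"
  define c where "c = measure M (ball x0 (\<epsilon> / 2))"
  have c: "c > 0"
    using ball_Good_pos[OF x0, of "\<epsilon> / 2"] assms by (simp add: c_def emeasure_eq_measure)
  have c_le: "c \<le> measure M (ball (orb n) (\<epsilon> / 2))" for n
    using ball_measure_T[of x0 "\<epsilon> / 2" n] x0 Good_subset by (auto simp: c_def emeasure_eq_measure)
  have "\<exists>K. finite K \<and> card K = N \<and> (\<forall>i\<in>K. \<forall>j\<in>K. i \<noteq> j \<longrightarrow> \<epsilon> \<le> D (orb i) (orb j))" for N
  proof (induction N)
    case (Suc N)
    then obtain K where K: "finite K" "card K = N" "\<forall>i\<in>K. \<forall>j\<in>K. i \<noteq> j \<longrightarrow> \<epsilon> \<le> D (orb i) (orb j)" by blast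
    then obtain n where n: "\<forall>k\<in>K. \<epsilon> \<le> D (orb k) (orb n)" using contr by (meson not_less)
    have "n \<notin> K" using n assms MD.mdist_zero[OF orb_in[of n]] by force
    then show ?case
      using K n MD.commute by (intro exI[of _ "insert n K"]) auto
  qed auto
  moreover obtain N :: nat where N: "measure M (space M) < N * c"
    using reals_Archimedean3[OF c] by blast
  ultimately obtain K where K: "finite K" "card K = N"
    "\<forall>i\<in>K. \<forall>j\<in>K. i \<noteq> j \<longrightarrow> \<epsilon> \<le> D (orb i) (orb j)" by blast
  have disj: "disjoint_family_on (\<lambda>n. ball (orb n) (\<epsilon> / 2)) K"
    unfolding disjoint_family_on_def
  proof (intro ballI impI)
    fix i j assume ij: "i \<in> K" "j \<in> K" "i \<noteq> j"
    have "\<epsilon> \<le> D (orb i) (orb j)" using K(3) ij by blast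
    then have "False" if "y \<in> ball (orb i) (\<epsilon> / 2)" "y \<in> ball (orb j) (\<epsilon> / 2)" for y
      using that MD.triangle[OF orb_in[of i] _ orb_in[of j], of y] MD.commute[of y "orb j"]
      by (simp add: ball_def)
    then show "ball (orb i) (\<epsilon> / 2) \<inter> ball (orb j) (\<epsilon> / 2) = {}" by blast
  qed
  have "N * c = (\<Sum>n\<in>K. c)" using K by simp
  also have "\<dots> \<le> (\<Sum>n\<in>K. measure M (ball (orb n) (\<epsilon> / 2)))" by (intro sum_mono c_le)
  also have "\<dots> = measure M (\<Union>n\<in>K. ball (orb n) (\<epsilon> / 2))"
    using K disj ball_sets orb_in by (intro finite_measure_finite_Union[symmetric]) auto
  also have "\<dots> \<le> measure M (space M)" by (rule bounded_measure)
  finally show False using N by simp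
qed

lemma D_orb_shift: "D (orb (i + k)) (orb (j + k)) = D (orb i) (orb j)"
  using D_T_pow[OF orb_Good orb_Good, of k i j] by (simp add: add.commute[of _ k] funpow_add)

end

section \<open>The isomorphism with a rotation\<close>

lemma (in finite_mp_system) AE_T_pow:
  assumes "AE x in M. P x" shows "AE x in M. \<forall>n. P ((T ^^ n) x)"
  unfolding AE_all_countable
proof
  fix n
  have distr: "distr M M (T ^^ n) = M"
    by (rule measure_eqI) (auto simp: emeasure_distr measurable_T_pow preserving_T_pow)
  have "AE x in distr M M (T ^^ n). P x" unfolding distr by (rule assms)
  then show "AE x in M. P ((T ^^ n) x)" by (rule AE_distrD[OF measurable_T_pow])
qed

lemma (in dense_orbit) rotation_ex:
  "\<exists>(G :: (nat \<Rightarrow> real) monoid) \<tau> m g.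
       compact_metrizable_group G \<tau> \<and> haar_measure G \<tau> m \<and>
       emeasure m (space m) = emeasure M (space M) \<and> g \<in> carrier G \<and>
       minimal_map \<tau> (rotation G g) \<and> uniformly_rigid \<tau> (rotation G g) \<and>
       isomorphic_mod0 M T m (rotation G g)"
proof -
  define \<delta> where "\<delta> i j = D (orb i) (orb j)" for i j
  have \<delta>_zero: "\<delta> i j = 0 \<longleftrightarrow> i = j" for i j
    using MD.zero[OF orb_in[of i] orb_in[of j]] inj_orb by (auto simp: \<delta>_def dest: injD)
  have "Metric_space UNIV \<delta>"
  proof
    show "\<delta> i k \<le> \<delta> i j + \<delta> j k" for i j k
      unfolding \<delta>_def by (rule MD.triangle[OF orb_in orb_in orb_in])
  qed (use \<delta>_zero in \<open>auto simp: \<delta>_def MD.commute\<close>)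
  moreover have "\<delta> i j \<le> 1" for i j unfolding \<delta>_def by (rule D_le_1)
  ultimately obtain S :: "(nat \<Rightarrow> real) set" and \<rho> F
    where S: "Metric_space S \<rho>" "Metric_space.mcomplete S \<rho>" "\<And>n. F n \<in> S"
      and \<rho>_F: "\<And>i j. \<rho> (F i) (F j) = \<delta> i j"
      and F_dense: "\<And>h \<epsilon>. h \<in> S \<Longrightarrow> \<epsilon> > 0 \<Longrightarrow> \<exists>i. \<rho> (F i) h < \<epsilon>"
      and eval: "\<And>h k n. h \<in> S \<Longrightarrow> k \<in> S \<Longrightarrow> \<bar>h n - k n\<bar> \<le> \<rho> h k"
    using metric_completion_seq[of \<delta>] by blast
  interpret S: Metric_space S \<rho> by fact
  interpret I: isometric_orbit S \<rho> F
  proof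
    show "S.mtotally_bounded (range F)"
      unfolding S.mtotally_bounded_def
    proof (intro allI impI)
      fix \<epsilon> :: real assume "\<epsilon> > 0"
      then obtain K where K: "finite K" "\<And>n. \<exists>k\<in>K. D (orb k) (orb n) < \<epsilon>"
        using orb_totally_bounded by blast
      have "range F \<subseteq> (\<Union>x\<in>F ` K. S.mball x \<epsilon>)"
        using K(2) S(3) by (auto simp: \<rho>_F \<delta>_def)
      then show "\<exists>K. finite K \<and> K \<subseteq> range F \<and> range F \<subseteq> (\<Union>x\<in>K. S.mball x \<epsilon>)"
        using K(1) by (intro exI[of _ "F ` K"]) auto
    qed
    show "inj F"
    proof (rule injI)
      fix i j assume "F i = F j"
      then have "\<delta> i j = 0" using \<rho>_F[of i j] S(3) S.mdist_zero by simp
      then show "i = j" using \<delta>_zero by simp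
    qed
  qed (use S F_dense \<rho>_F in \<open>auto simp: \<delta>_def D_orb_shift\<close>)
  \<comment> \<open>One index sequence describes both a point of \<open>Good\<close>, through
    \<open>D\<close>, and a point of the group, through \<open>I.conv\<close>; matching the two
    gives the isometric extension \<phi> of the map taking \<open>orb n\<close> to
    \<open>F n\<close>.\<close>
  define lim where "lim u x \<longleftrightarrow> (\<lambda>k. D (orb (u k)) x) \<longlonglongrightarrow> 0" for u :: "nat \<Rightarrow> nat" and x
  have lim_ex: "\<exists>u. lim u x" if "x \<in> Good" for x
  proof -
    have "\<forall>k. \<exists>n. D (orb n) x < inverse (real (Suc k))"
      using dense[OF that] by simp
    then obtain u where u: "\<And>k. D (orb (u k)) x < inverse (real (Suc k))" by metis
    have "lim u x" unfolding lim_def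
      by (rule tendsto_sandwich[OF _ _ tendsto_const LIMSEQ_inverse_real_of_nat])
        (use u in \<open>auto intro!: always_eventually less_imp_le\<close>)
    then show ?thesis by blast
  qed
  have lim_dist: "(\<lambda>k. \<rho> (F (u k)) (F (v k))) \<longlonglongrightarrow> D x y"
    if "lim u x" "lim v y" "x \<in> Good" "y \<in> Good" for u v x y
    unfolding \<rho>_F \<delta>_def using that Good_subset orb_in unfolding lim_def
    by (intro MD.tendsto_metric) auto
  \<comment> \<open>A single limit h has to serve every sequence that represents x, so that \<phi>
    does not depend on the choice.\<close>
  have "\<exists>h. \<forall>u. lim u x \<longrightarrow> I.conv u h" if x: "x \<in> Good" for x
  proof -
    have xM: "x \<in> space M" using x Good_subset by blast
    obtain u where u: "lim u x" using lim_ex[OF x] by blast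
    have "I.Cauchy_index u"
      unfolding I.Cauchy_index_def
    proof (intro allI impI)
      fix \<epsilon> :: real assume "\<epsilon> > 0"
      then obtain N where N: "\<And>k. k \<ge> N \<Longrightarrow> D (orb (u k)) x < \<epsilon> / 2"
        using order_tendstoD(2)[OF u[unfolded lim_def], of "\<epsilon> / 2"] unfolding eventually_sequentially by auto
      have "\<rho> (F (u k)) (F (u l)) < \<epsilon>" if "k \<ge> N" "l \<ge> N" for k l
        using MD.triangle[OF orb_in[of "u k"] xM orb_in[of "u l"]] N[OF that(1)] N[OF that(2)]
          MD.commute[of x] by (simp add: \<rho>_F \<delta>_def)
      then show "\<exists>N. \<forall>k\<ge>N. \<forall>l\<ge>N. \<rho> (F (u k)) (F (u l)) < \<epsilon>" by blast
    qed
    then obtain h where h: "I.conv u h" using I.Cauchy_index_conv by blast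
    have "I.conv v h" if "lim v x" for v
      using I.conv_close[OF h] lim_dist[OF u that x x] MD.mdist_zero[OF xM] by simp
    then show ?thesis by blast
  qed
  then obtain \<phi> where \<phi>: "\<And>x u. x \<in> Good \<Longrightarrow> lim u x \<Longrightarrow> I.conv u (\<phi> x)" by metis
  have \<phi>_in: "\<phi> x \<in> S" if "x \<in> Good" for x
    using \<phi>[OF that] lim_ex[OF that] I.conv_in by blast
  have \<phi>_dist: "\<rho> (\<phi> x) (\<phi> y) = D x y" if xy: "x \<in> Good" "y \<in> Good" for x y
  proof -
    obtain u v where uv: "lim u x" "lim v y" using lim_ex xy by blast
    show ?thesis
      using LIMSEQ_unique[OF I.conv_dist[OF \<phi>[OF xy(1) uv(1)] \<phi>[OF xy(2) uv(2)]] lim_dist[OF uv xy]] .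
  qed
  have \<phi>_orb: "\<phi> (orb n) = F n" for n
  proof -
    have "lim (\<lambda>_. n) (orb n)" unfolding lim_def using MD.mdist_zero[OF orb_in[of n]] by simp
    from \<phi>[OF orb_Good this] show ?thesis using I.conv_unique[OF _ I.conv_const] by blast
  qed
  have \<phi>_T: "\<phi> (T x) = I.mult (F 1) (\<phi> x)" if x: "x \<in> Good" for x
  proof -
    have xM: "x \<in> space M" using x Good_subset by blast
    obtain u where u: "lim u x" using lim_ex[OF x] by blast
    \<comment> \<open>Raising the indices by one follows \<open>T\<close> in the space and
      multiplies by \<open>F 1\<close> in the group; uniqueness of limits then gives the
      intertwining relation.\<close>
    have "lim (\<lambda>k. 1 + u k) (T x)"
      unfolding lim_def
    proof (rule tendsto_sandwich[OF _ _ tendsto_const u[unfolded lim_def]])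
      show "\<forall>\<^sub>F k in sequentially. D (orb (1 + u k)) (T x) \<le> D (orb (u k)) x"
        using D_T_le[OF orb_in xM] by simp
    qed simp
    from \<phi>[OF T_Good[OF x] this] show ?thesis
      using I.conv_unique I.conv_mult[OF I.conv_const[of 1] \<phi>[OF x u]] by blast
  qed
  have \<phi>_inj: "inj_on \<phi> Good"
  proof (rule inj_onI)
    fix x y assume xy: "x \<in> Good" "y \<in> Good" "\<phi> x = \<phi> y"
    then have "D x y = 0" using \<phi>_dist[OF xy(1,2)] S.mdist_zero[OF \<phi>_in[OF xy(2)]] by simp
    then show "x = y" using MD.zero xy Good_subset by blast
  qed

  \<comment> \<open>The value \<open>F 0\<close> off the conull set \<open>Good\<close> makes the
    map total with values in S, as measurability on all of M requires.\<close>
  define \<phi>' where "\<phi>' x = (if x \<in> Good then \<phi> x else F 0)" for x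
  have \<phi>'_in: "\<phi>' x \<in> S" for x using \<phi>_in S(3) by (simp add: \<phi>'_def)
  have \<phi>'_inj: "inj_on \<phi>' Good" using \<phi>_inj by (simp add: \<phi>'_def inj_on_def)
  define N where "N = sigma S {U. openin S.mtopology U}"
  have opens: "{U. openin S.mtopology U} \<subseteq> Pow S" by (auto simp: S.openin_mtopology)
  have N: "space N = S" "sets N = borel_sets_of S.mtopology"
    unfolding N_def borel_sets_of_def using opens by (simp_all add: space_measure_of sets_measure_of)
  have open_N: "U \<in> sets N" if "openin S.mtopology U" for U
    using that unfolding N borel_sets_of_def by (auto intro: sigma_sets.Basic)
  have \<phi>'_N: "\<phi>' \<in> measurable M N"
    unfolding N_def
  proof (rule measurable_measure_of[OF opens])
    fix U assume "U \<in> {U. openin S.mtopology U}"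
    then have U: "openin S.mtopology U" "U \<subseteq> S" by (auto simp: S.openin_mtopology)
    define J where "J = {(i, k). S.mball (F i) (inverse (real (Suc k))) \<subseteq> U}"
    \<comment> \<open>On \<open>Good\<close> the preimage of U is a union of \<open>D\<close>-balls;
      centres on the orbit and radii from a sequence suffice, so the union is countable and hence
      measurable.\<close>
    define B where "B = (\<Union>(i, k)\<in>J. ball (orb i) (inverse (real (Suc k))))"
    have "x \<in> B \<longleftrightarrow> \<phi> x \<in> U" if x: "x \<in> Good" for x
    proof
      assume "x \<in> B"
      then obtain i k where ik: "(i, k) \<in> J" "D (orb i) x < inverse (real (Suc k))" by (auto simp: B_def ball_def)
      then have "\<phi> x \<in> S.mball (F i) (inverse (real (Suc k)))"
        using \<phi>_dist[OF orb_Good x, of i] \<phi>_in[OF x] S(3) by (simp add: \<phi>_orb)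
      then show "\<phi> x \<in> U" using ik by (auto simp: J_def)
    next
      assume "\<phi> x \<in> U"
      then obtain r where r: "r > 0" "S.mball (\<phi> x) r \<subseteq> U" using U unfolding S.openin_mtopology by blast
      obtain k where k: "inverse (real (Suc k)) < r / 2"
        using reals_Archimedean[of "r / 2"] r by auto
      obtain i where i: "\<rho> (F i) (\<phi> x) < inverse (real (Suc k))"
        using F_dense[OF \<phi>_in[OF x], of "inverse (real (Suc k))"] by auto
      have "S.mball (F i) (inverse (real (Suc k))) \<subseteq> S.mball (\<phi> x) r"
        using i k \<phi>_in[OF x] by (intro S.mball_subset) auto
      then have "(i, k) \<in> J" using r by (auto simp: J_def)
      moreover have "x \<in> ball (orb i) (inverse (real (Suc k)))"
        using i \<phi>_dist[OF orb_Good x, of i] x Good_subset by (auto simp: \<phi>_orb ball_def)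
      ultimately show "x \<in> B" unfolding B_def by blast
    qed
    then have "\<phi>' -` U \<inter> space M = (Good \<inter> B) \<union>
        (if F 0 \<in> U then space M - Good else {})"
      using Good_subset by (auto simp: \<phi>'_def split: if_splits)
    moreover have "B \<in> sets M"
      unfolding B_def by (rule sets.countable_UN') (auto intro: ball_sets orb_in)
    ultimately show "\<phi>' -` U \<inter> space M \<in> sets M" using Good_conull(1) by simp
  qed (use \<phi>'_in in auto)
  \<comment> \<open>Evaluations are 1-Lipschitz for \<rho>, so Borel subsets of
    \<open>nat \<Rightarrow> real\<close> cut out measurable subsets of S. This brings the
    measurability of images back to N.\<close>
  have incl: "(\<lambda>h. h) \<in> measurable N borel"
  proof (rule measurable_coordinatewise_then_product)
    fix n
    show "(\<lambda>h. h n) \<in> borel_measurable N"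
      unfolding borel_measurable_iff_less
    proof
      fix a
      have "openin S.mtopology {h \<in> S. h n < a}"
        unfolding S.openin_mtopology
      proof (intro conjI allI impI)
        fix h assume h: "h \<in> {h \<in> S. h n < a}"
        have "S.mball h (a - h n) \<subseteq> {h \<in> S. h n < a}"
        proof
          fix k assume k: "k \<in> S.mball h (a - h n)"
          then show "k \<in> {h \<in> S. h n < a}" using eval[of h k n] by (auto simp: abs_le_iff)
        qed
        then show "\<exists>r>0. S.mball h r \<subseteq> {h \<in> S. h n < a}" using h by (intro exI[of _ "a - h n"]) auto
      qed auto
      then show "{h \<in> space N. h n < a} \<in> sets N" using open_N by (simp add: N)
    qed
  qed
  have \<phi>'_borel: "\<phi>' \<in> borel_measurable M" using measurable_compose[OF \<phi>'_N incl] .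
  obtain U where U: "U \<in> sets M" "U \<subseteq> Good" "emeasure M (Good - U) = 0"
    and U_image: "\<And>A. A \<in> sets M \<Longrightarrow> A \<subseteq> U \<Longrightarrow> \<phi>' ` A \<in> sets borel"
    using injective_images_measurable_AE[OF standard finite_measure_axioms \<phi>'_borel Good_conull(1) \<phi>'_inj]
    by blast
  have image_N: "\<phi>' ` A \<in> sets N" if "A \<in> sets M" "A \<subseteq> U" for A
  proof -
    have "(\<lambda>h. h) -` (\<phi>' ` A) \<inter> space N \<in> sets N"
      using incl U_image[OF that] by (rule measurable_sets)
    moreover have "(\<lambda>h. h) -` (\<phi>' ` A) \<inter> space N = \<phi>' ` A" using \<phi>'_in by (auto simp: N)
    ultimately show ?thesis by simp
  qed
  have "AE x in M. x \<in> U"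
  proof -
    have "AE x in M. x \<notin> Good - U"
      using U Good_conull(1) by (intro AE_not_in) auto
    then show ?thesis using AE_Good by eventually_elim blast
  qed
  then have AE_V: "AE x in M. \<forall>n. (T ^^ n) x \<in> U" by (rule AE_T_pow)
  \<comment> \<open>The set U is conull but need not be invariant. The points whose whole forward
    orbit stays in U form a forward-invariant set, still conull because preimages of null sets are
    null.\<close>
  define V where "V = {x \<in> space M. \<forall>n. (T ^^ n) x \<in> U}"
  have V_sets: "V \<in> sets M"
  proof -
    have "V = (\<Inter>n. (T ^^ n) -` U \<inter> space M)" by (auto simp: V_def)
    also have "\<dots> \<in> sets M"
      using measurable_sets[OF measurable_T_pow U(1)] by (intro sets.countable_INT) auto
    finally show ?thesis .
  qed
  have VU: "V \<subseteq> U"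
  proof
    fix x assume "x \<in> V"
    then have "(T ^^ 0) x \<in> U" unfolding V_def by blast
    then show "x \<in> U" by simp
  qed
  have V_good: "V \<subseteq> Good" using VU U by blast
  have V_AE: "AE x in M. x \<in> V" using AE_V AE_space by eventually_elim (simp add: V_def)
  have T_V: "T x \<in> V" if "x \<in> V" for x
  proof -
    have "(T ^^ n) (T x) \<in> U" for n
    proof -
      have "(T ^^ Suc n) x \<in> U" using that unfolding V_def by blast
      then show ?thesis by (simp add: funpow_Suc_right del: funpow.simps)
    qed
    then show ?thesis using that T_in by (simp add: V_def)
  qed
  define \<nu> where "\<nu> = distr M N \<phi>'"
  have \<nu>: "emeasure \<nu> A = emeasure M (\<phi>' -` A \<inter> space M)" if "A \<in> sets N" for A
    unfolding \<nu>_def using \<phi>'_N that by (rule emeasure_distr)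
  have \<nu>_sp: "space \<nu> = S" "sets \<nu> = sets N" by (simp_all add: \<nu>_def N)
  have mass: "emeasure \<nu> (space \<nu>) = emeasure M (space M)"
  proof -
    have "S \<in> sets N" using sets.top[of N] by (simp add: N)
    moreover have "\<phi>' -` S \<inter> space M = space M" using \<phi>'_in by auto
    ultimately show ?thesis by (simp add: \<nu> \<nu>_sp)
  qed
  have haar: "haar_measure I.G S.mtopology \<nu>"
  proof (rule I.haar_measure_G)
    show "0 < emeasure \<nu> (space \<nu>)" "emeasure \<nu> (space \<nu>) < \<infinity>"
      using mass positive_mass by (simp_all add: emeasure_eq_measure)
    fix A assume "A \<in> sets \<nu>"
    then have A: "A \<in> sets N" by (simp add: \<nu>_sp)
    have cont: "I.mult (F 1) \<in> measurable N N"
      unfolding N_def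
    proof (rule measurable_measure_of[OF opens])
      fix U assume "U \<in> {U. openin S.mtopology U}"
      then have "openin S.mtopology {x \<in> topspace S.mtopology. I.mult (F 1) x \<in> U}"
        using I.continuous_mult[OF S(3)] by (intro openin_continuous_map_preimage) auto
      then show "I.mult (F 1) -` U \<inter> space (sigma S {U. openin S.mtopology U}) \<in> sets (sigma S {U. openin S.mtopology U})"
        using open_N unfolding N_def[symmetric] by (simp add: N vimage_def Int_def conj_commute)
    qed (use I.mult_in S(3) in \<open>auto simp: N_def[symmetric] N\<close>)
    have RA: "{x \<in> S. I.mult (F 1) x \<in> A} \<in> sets N"
      using measurable_sets[OF cont A] by (simp add: N vimage_def Int_def conj_commute)
    have "emeasure \<nu> {x \<in> S. I.mult (F 1) x \<in> A} = emeasure M (\<phi>' -` {x \<in> S. I.mult (F 1) x \<in> A} \<inter> space M)"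
      by (rule \<nu>[OF RA])
    \<comment> \<open>The intertwining relation is known on \<open>Good\<close> only, so the two
      preimages are compared up to a null set.\<close>
    also have "\<dots> = emeasure M (T -` (\<phi>' -` A \<inter> space M) \<inter> space M)"
    proof (rule emeasure_eq_AE)
      show "AE x in M. x \<in> \<phi>' -` {x \<in> S. I.mult (F 1) x \<in> A} \<inter> space M \<longleftrightarrow>
          x \<in> T -` (\<phi>' -` A \<inter> space M) \<inter> space M"
        using AE_Good AE_space
        by eventually_elim (simp add: \<phi>'_def T_Good T_in \<phi>_T \<phi>_in)
      show "\<phi>' -` {x \<in> S. I.mult (F 1) x \<in> A} \<inter> space M \<in> sets M"
        using \<phi>'_N RA by (rule measurable_sets)
      show "T -` (\<phi>' -` A \<inter> space M) \<inter> space M \<in> sets M"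
        by (rule measurable_sets[OF measurable_T measurable_sets[OF \<phi>'_N A]])
    qed
    also have "\<dots> = emeasure \<nu> A" using preserving[OF measurable_sets[OF \<phi>'_N A]] \<nu>[OF A] by simp
    finally show "emeasure \<nu> {x \<in> S. I.mult (F 1) x \<in> A} = emeasure \<nu> A" .
  qed (simp_all add: \<nu>_sp N)
  have \<phi>'_V_inj: "inj_on \<phi>' V" using \<phi>'_inj V_good by (rule inj_on_subset)
  have V_image: "\<phi>' ` V \<in> sets N" using image_N V_sets VU by blast
  have V_sub: "V \<subseteq> space M" by (auto simp: V_def)
  have equiv: "\<phi>' (T x) = rotation I.G (F 1) (\<phi>' x)" if "x \<in> V" for x
    using \<phi>_T[of x] that V_good T_Good[of x] by (auto simp: \<phi>'_def rotation_def)
  have iso: "isomorphic_mod0 M T \<nu> (rotation I.G (F 1))"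
    unfolding isomorphic_mod0_def
  proof (rule bexI[of _ V], rule bexI[of _ "\<phi>' ` V"], intro exI[of _ \<phi>'] conjI)
    show "emeasure M (space M - V) = 0"
      using V_AE V_sets by (subst (asm) AE_iff_measurable[of "space M - V"]) auto
    show "emeasure \<nu> (space \<nu> - \<phi>' ` V) = 0"
    proof -
      have "\<phi>' -` (S - \<phi>' ` V) \<inter> space M \<subseteq> space M - V" by auto
      then have "emeasure M (\<phi>' -` (S - \<phi>' ` V) \<inter> space M) \<le> emeasure M (space M - V)"
        using V_sets by (intro emeasure_mono) auto
      also have "\<dots> = 0" by fact
      finally have "emeasure M (\<phi>' -` (S - \<phi>' ` V) \<inter> space M) = 0" by simp
      moreover have "S - \<phi>' ` V \<in> sets N" using sets.compl_sets[OF V_image] by (simp add: N)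
      ultimately show ?thesis by (simp add: \<nu> \<nu>_sp)
    qed
    show "T ` V \<subseteq> V" using T_V by blast
    show "rotation I.G (F 1) ` \<phi>' ` V \<subseteq> \<phi>' ` V"
    proof
      fix h assume "h \<in> rotation I.G (F 1) ` \<phi>' ` V"
      then obtain x where "x \<in> V" "h = \<phi>' (T x)" using equiv by auto
      then show "h \<in> \<phi>' ` V" using T_V by blast
    qed
    show "bij_betw \<phi>' V (\<phi>' ` V)" using \<phi>'_V_inj by (rule inj_on_imp_bij_betw)
    show "\<phi>' \<in> measurable (restrict_space M V) (restrict_space \<nu> (\<phi>' ` V))"
    proof (rule measurable_restrict_space3)
      show "\<phi>' \<in> measurable M \<nu>" using \<phi>'_N by (simp add: \<nu>_def)
    qed auto
    show "the_inv_into V \<phi>' \<in> measurable (restrict_space \<nu> (\<phi>' ` V)) (restrict_space M V)"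
    proof (rule measurableI)
      fix h assume "h \<in> space (restrict_space \<nu> (\<phi>' ` V))"
      then have "h \<in> \<phi>' ` V" by (simp add: space_restrict_space)
      then have "the_inv_into V \<phi>' h \<in> V" using the_inv_into_into[OF \<phi>'_V_inj] by blast
      then show "the_inv_into V \<phi>' h \<in> space (restrict_space M V)"
        using V_sub by (auto simp: space_restrict_space)
    next
      fix A assume "A \<in> sets (restrict_space M V)"
      then have A: "A \<in> sets M" "A \<subseteq> V"
        using V_sets by (auto simp: sets_restrict_space)
      have "the_inv_into V \<phi>' -` A \<inter> space (restrict_space \<nu> (\<phi>' ` V)) = \<phi>' ` V \<inter> \<phi>' ` A"
      proof -
        have "space (restrict_space \<nu> (\<phi>' ` V)) = \<phi>' ` V"
          using \<phi>'_in by (auto simp: space_restrict_space \<nu>_sp)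
        then show ?thesis using the_inv_into_f_f[OF \<phi>'_V_inj] A by auto
      qed
      moreover have "\<phi>' ` A \<in> sets \<nu>" using image_N A VU by (auto simp: \<nu>_sp)
      ultimately show "the_inv_into V \<phi>' -` A \<inter> space (restrict_space \<nu> (\<phi>' ` V)) \<in> sets (restrict_space \<nu> (\<phi>' ` V))"
        by (simp add: sets_restrict_space)
    qed
    show "\<forall>A\<in>sets M. A \<subseteq> V \<longrightarrow> emeasure \<nu> (\<phi>' ` A) = emeasure M A"
    proof (intro ballI impI)
      fix A assume A: "A \<in> sets M" "A \<subseteq> V"
      have im: "\<phi>' ` A \<in> sets N" using image_N A VU by blast
      \<comment> \<open>Points outside \<open>Good\<close> are all sent to \<open>F 0\<close>, which
        may lie in the image of A, so the preimage agrees with A only almost everywhere.\<close>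
      have "emeasure M (\<phi>' -` \<phi>' ` A \<inter> space M) = emeasure M A"
      proof (rule emeasure_eq_AE)
        show "AE x in M. x \<in> \<phi>' -` \<phi>' ` A \<inter> space M \<longleftrightarrow> x \<in> A"
          using V_AE AE_space
        proof eventually_elim
          case (elim x)
          then show ?case using inj_on_image_mem_iff[OF \<phi>'_V_inj elim(1) A(2)] by simp
        qed
        show "\<phi>' -` \<phi>' ` A \<inter> space M \<in> sets M" using \<phi>'_N im by (rule measurable_sets)
      qed fact
      then show "emeasure \<nu> (\<phi>' ` A) = emeasure M A" by (simp add: \<nu>[OF im])
    qed
    show "\<forall>x\<in>V. \<phi>' (T x) = rotation I.G (F 1) (\<phi>' x)" using equiv by blast
  qed (use V_image V_sets in \<open>simp_all add: \<nu>_sp\<close>)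
  show ?thesis
    using I.compact_metrizable_group_G haar mass S(3) I.minimal_rotation I.uniformly_rigid_rotation iso
    by (intro exI[of _ I.G] exI[of _ S.mtopology] exI[of _ \<nu>] exI[of _ "F 1"]) simp
qed

theorem theorem2:
  fixes M :: "'a measure" and T :: "'a \<Rightarrow> 'a"
  assumes "finite_mp_system M T"
    and "ergodic M T"
  shows "W_measurably_sensitive M T \<or>
    (\<exists>(G :: (nat \<Rightarrow> real) monoid) \<tau> m g.
       compact_metrizable_group G \<tau> \<and> haar_measure G \<tau> m \<and>
       emeasure m (space m) = emeasure M (space M) \<and> g \<in> carrier G \<and>
       minimal_map \<tau> (rotation G g) \<and> uniformly_rigid \<tau> (rotation G g) \<and>
       isomorphic_mod0 M T m (rotation G g))"
proof (cases "W_measurably_sensitive M T")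
  case False
  then obtain d where "compatible_metric M d" "\<not> W_sensitive_wrt M T d"
    unfolding W_measurably_sensitive_def by blast
  with assms interpret insensitive_system M T d
    by (simp add: insensitive_system_def insensitive_system_axioms_def)
  obtain x where "x \<in> Good" "\<forall>y\<in>Good. \<forall>\<epsilon>>0. \<exists>n. D ((T ^^ n) x) y < \<epsilon>"
    using dense_orbit_ex by blast
  then interpret dense_orbit M T d x by unfold_locales auto
  from rotation_ex show ?thesis ..
qed simp

end
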